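(* Let $x\cdot A=y$ be a left system of linear equations with matrix of coefficients $A\in \mathrm{M}(n,\mathbf{H})$, row of constants $y=(y_1,\ldots,y_n)\in\mathbf{H}^{1\times n}$ and row of unknowns $x=(x_1,\ldots,x_n)$. If $\mathrm{ddet}\,A\neq 0$, then the solution to this linear system is given by components $$x_i=\frac{\mathrm{rdet}_i\,(AA^* )_{i.}(z)}{\mathrm{ddet}\,A},\qquad i=1,\ldots,n,$$ where $z=yA^*$.
   Context: $\mathbf{H}$ is the skew field of real quaternions; $\mathrm{M}(n,\mathbf{H})$ is the ring of $n\times n$ matrices over $\mathbf{H}$; $A^*$ is the conjugate transpose of $A$; a matrix $B$ is Hermitian if $B=B^*$. Row determinants: for $A=(a_{pq})\in \mathrm{M}(n,\mathbf{H})$ and $i\in\{1,\ldots,n\}$, $$\mathrm{rdet}_i A=\sum_{\sigma\in S_n}(-1)^{n-r}a_{i\,i_{k_1}}a_{i_{k_1}i_{k_1+1}}\cdots a_{i_{k_1+l_1}i}\cdots a_{i_{k_r}i_{k_r+1}}\cdots a_{i_{k_r+l_r}i_{k_r}},$$ where each $\sigma\in S_n$ is written as a product of its $r$ disjoint cycles (fixed points included) $\sigma=(i\,i_{k_1}i_{k_1+1}\ldots i_{k_1+l_1})(i_{k_2}\ldots i_{k_2+l_2})\ldots(i_{k_r}\ldots i_{k_r+l_r})$, each entry of a cycle being mapped to the next; the first cycle starts with $i$, every other cycle starts with its smallest element, and $i_{k_2}<i_{k_3}<\cdots<i_{k_r}$. A fixed point $p$ contributes the factor $a_{pp}$. For Hermitian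 $B\in \mathrm{M}(n,\mathbf{H})$ all row determinants $\mathrm{rdet}_iB$ coincide and are real; the common value is denoted $\det B$. The double determinant of $A$ is $\mathrm{ddet}\,A:=\det(A^*A)=\det(AA^* )$ (the two values coincide). $B_{i.}(v)$ denotes the matrix obtained from $B$ by replacing its $i$th row with the row $v$. *)

theory Defs
  imports Complex_Main "HOL-Combinatorics.Cycles" "Jordan_Normal_Form.Matrix"
begin

section \<open>The skew field of real quaternions\<close>

text \<open>\<open>Quat a b c d\<close> stands for \<open>a + b i + c j + d k\<close>, where
  \<open>i\<^sup>2 = j\<^sup>2 = k\<^sup>2 = i j k = -1\<close>.\<close>

datatype quat = Quat (q0: real) (q1: real) (q2: real) (q3: real)

instantiation quat :: real_div_algebra
begin

definition "0 = Quat 0 0 0 0"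
definition "1 = Quat 1 0 0 0"
definition "p + q = Quat (q0 p + q0 q) (q1 p + q1 q) (q2 p + q2 q) (q3 p + q3 q)"
definition "p - q = Quat (q0 p - q0 q) (q1 p - q1 q) (q2 p - q2 q) (q3 p - q3 q)"
definition "- q = Quat (- q0 q) (- q1 q) (- q2 q) (- q3 q)"
definition "p * q = Quat
  (q0 p * q0 q - q1 p * q1 q - q2 p * q2 q - q3 p * q3 q)
  (q0 p * q1 q + q1 p * q0 q + q2 p * q3 q - q3 p * q2 q)
  (q0 p * q2 q - q1 p * q3 q + q2 p * q0 q + q3 p * q1 q)
  (q0 p * q3 q + q1 p * q2 q - q2 p * q1 q + q3 p * q0 q)"
definition "r *\<^sub>R q = Quat (r * q0 q) (r * q1 q) (r * q2 q) (r * q3 q)"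
definition "inverse q =
  (1 / ((q0 q)\<^sup>2 + (q1 q)\<^sup>2 + (q2 q)\<^sup>2 + (q3 q)\<^sup>2)) *\<^sub>R Quat (q0 q) (- q1 q) (- q2 q) (- q3 q)"
definition "p div q = p * inverse q" for p q :: quat

lemmas quat_defs = zero_quat_def one_quat_def plus_quat_def minus_quat_def uminus_quat_def
  times_quat_def scaleR_quat_def inverse_quat_def divide_quat_def

lemma quat_norm_nonzero:
  assumes "q \<noteq> (0::quat)"
  shows "(q0 q)\<^sup>2 + (q1 q)\<^sup>2 + (q2 q)\<^sup>2 + (q3 q)\<^sup>2 \<noteq> 0"
  using assms by (cases q) (auto simp: zero_quat_def add_nonneg_eq_0_iff)

instance
proof
  fix p q r :: quat and a b :: real
  show "p + q + r = p + (q + r)" "p + q = q + p" "0 + p = p" "- p + p = 0" "p - q = p + - q"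
    "p * q * r = p * (q * r)" "1 * p = p" "p * 1 = p" "(p + q) * r = p * r + q * r"
    "p * (q + r) = p * q + p * r" "(0::quat) \<noteq> 1"
    "a *\<^sub>R (p + q) = a *\<^sub>R p + a *\<^sub>R q" "(a + b) *\<^sub>R p = a *\<^sub>R p + b *\<^sub>R p"
    "a *\<^sub>R b *\<^sub>R p = (a * b) *\<^sub>R p" "1 *\<^sub>R p = p"
    "a *\<^sub>R p * q = a *\<^sub>R (p * q)" "p * a *\<^sub>R q = a *\<^sub>R (p * q)"
    "inverse (0::quat) = 0" "p div q = p * inverse q"
    by (simp_all add: quat_defs algebra_simps)
  assume "p \<noteq> 0"
  define N where "N = (q0 p)\<^sup>2 + (q1 p)\<^sup>2 + (q2 p)\<^sup>2 + (q3 p)\<^sup>2"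
  have "N \<noteq> 0" using quat_norm_nonzero[OF \<open>p \<noteq> 0\<close>] by (simp add: N_def)
  then show "inverse p * p = 1" "p * inverse p = 1"
    unfolding inverse_quat_def N_def[symmetric]
    by (simp_all add: quat_defs field_simps) (simp_all add: N_def power2_eq_square)
qed

end

definition qcnj :: "quat \<Rightarrow> quat"
  where "qcnj q = Quat (q0 q) (- q1 q) (- q2 q) (- q3 q)"

section \<open>Matrices over the quaternions\<close>

text \<open>Rows, columns and row indices are numbered from \<open>0\<close>. Row vectors are matrices with one
  row, so that the product of a row \<open>x\<close> and a matrix \<open>A\<close> is the matrix product \<open>x * A\<close>, with
  entries \<open>\<Sum>j. x\<^sub>j a\<^sub>j\<^sub>i\<close> (coefficients on the right).\<close>

definition conj_transpose :: "quat mat \<Rightarrow> quat mat"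
  where "conj_transpose A = map_mat qcnj (transpose_mat A)"

definition replace_row :: "'a mat \<Rightarrow> nat \<Rightarrow> 'a mat \<Rightarrow> 'a mat"
  where "replace_row B i v =
    mat (dim_row B) (dim_col B) (\<lambda>(p, q). if p = i then v $$ (0, q) else B $$ (p, q))"

text \<open>\<open>support \<sigma> p\<close> is the list \<open>[p, \<sigma> p, \<sigma> (\<sigma> p), \<dots>]\<close> running once through the cycle of
  \<open>p\<close>. \<open>cycle_heads n i \<sigma>\<close> lists the first elements of the cycles of \<open>\<sigma>\<close> in the order in which
  they are written: \<open>i\<close>, then in increasing order the smallest elements of the cycles
  (fixed points included) that do not contain \<open>i\<close>. Its length is the number of cycles.\<close>

definition cycle_heads :: "nat \<Rightarrow> nat \<Rightarrow> (nat \<Rightarrow> nat) \<Rightarrow> nat list"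
  where "cycle_heads n i \<sigma> = i # sorted_list_of_set
    {p. p < n \<and> i \<notin> set (support \<sigma> p) \<and> p = Min (set (support \<sigma> p))}"

definition cycle_prod :: "quat mat \<Rightarrow> (nat \<Rightarrow> nat) \<Rightarrow> nat \<Rightarrow> quat"
  where "cycle_prod A \<sigma> p = prod_list (map (\<lambda>q. A $$ (q, \<sigma> q)) (support \<sigma> p))"

definition rdet :: "nat \<Rightarrow> quat mat \<Rightarrow> quat"
  where "rdet i A = (\<Sum>\<sigma> | \<sigma> permutes {0..<dim_row A}.
    (- 1) ^ (dim_row A - length (cycle_heads (dim_row A) i \<sigma>)) *
    prod_list (map (cycle_prod A \<sigma>) (cycle_heads (dim_row A) i \<sigma>)))"

text \<open>The common real value of the row determinants of \<open>B\<close>; meaningful only when these do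
  coincide and are real, as for Hermitian \<open>B\<close> of positive size.\<close>

definition herm_det :: "quat mat \<Rightarrow> real"
  where "herm_det B = (THE d. \<forall>i < dim_row B. rdet i B = of_real d)"

definition ddet :: "quat mat \<Rightarrow> real"
  where "ddet A = herm_det (conj_transpose A * A)"

end

theory Submission
  imports Defs
begin

text \<open>
Put \<open>B = A A\<^sup>*\<close>. The row determinant \<open>rdet\<^sub>i\<close> is left linear in row \<open>i\<close>, because the entry of
that row is the first factor of every term. If \<open>x A = y\<close>, then \<open>z = y A\<^sup>* = x B\<close> is the left linear
combination of the rows of \<open>B\<close> with coefficients \<open>x\<^sub>k\<close>. So Cramer's rule follows as over a
field, once three facts about Hermitian matrices are known: all \<open>rdet\<^sub>i B\<close> are the same real number
(\<open>rdet_hermitian\<close>); \<open>rdet\<^sub>i\<close> vanishes if row \<open>i\<close> of \<open>B\<close> is overwritten by another row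
(\<open>rdet_equal_rows\<close>); and \<open>det (A A\<^sup>*) = det (A\<^sup>* A)\<close> (\<open>moore_det_gram_adjoint\<close>).

All three rest on reversing a cycle. In a Hermitian matrix the reversed cycle of a permutation has
the conjugate product, while the sign and the other cycles stay the same. Averaging over both
orientations, one cycle after the other, replaces every cycle product by its real part.
Real parts commute with everything and depend only on the cycle, not on its starting point.
Hence \<open>rdet\<^sub>i B\<close> equals \<open>moore_det\<close>, the signed sum of the products of real parts, for each \<open>i\<close>.

For the second fact, two cycles through \<open>i\<close> and \<open>k\<close>, with products \<open>Q\<close> and \<open>P\<close>, are joined into one.
As the rows agree, the joined cycle has product \<open>P Q\<close> and carries the opposite sign. The
difference between \<open>P Q\<close> and \<open>(Re P) Q\<close> disappears under reversal of the second cycle.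

For the third fact, \<open>det\<close> is summed over all matrices \<open>(b (f p) (f q))\<close> with an arbitrary self-map \<open>f\<close> of
the indices. Only bijections contribute, by the second fact, and each contributes \<open>det B\<close>. After
expanding \<open>b\<^sub>p\<^sub>q\<close> in the entries of \<open>A\<close>, each cycle carries a cyclic word in which entries of \<open>A\<close> and
of \<open>A\<^sup>*\<close> alternate. Starting the word with the one or with the other kind of letter gives the
expansion for \<open>A A\<^sup>*\<close> or for \<open>A\<^sup>* A\<close>, and the real part does not notice the difference.

For the converse, Cramer's rule makes the cofactors into two-sided inverses of \<open>A A\<^sup>*\<close> and \<open>A\<^sup>* A\<close>
(\<open>hermitian_cramer_inverse\<close>). The formula then says \<open>x = y A\<^sup>* (A A\<^sup>*)\<^sup>-\<^sup>1\<close>, whence \<open>x A A\<^sup>* = y A\<^sup>*\<close>, and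
\<open>A\<^sup>*\<close> is cancelled by means of the inverse of \<open>A\<^sup>* A\<close>.
\<close>

section \<open>Cycles of a permutation and their reversal\<close>

definition cyc :: "('a \<Rightarrow> 'a) \<Rightarrow> 'a \<Rightarrow> 'a list"
  where "cyc \<sigma> p = support \<sigma> p"

abbreviation orb :: "('a \<Rightarrow> 'a) \<Rightarrow> 'a \<Rightarrow> 'a set"
  where "orb \<sigma> p \<equiv> set (cyc \<sigma> p)"

text \<open>Mapping \<open>\<sigma>\<close> over the list rotates it: this one equation says that \<open>\<sigma>\<close> runs through the
distinct list cyclically. A cycle of a modified permutation is found by writing down the
candidate list, checking this equation, and applying the uniqueness rule \<open>cyc_eqI\<close>.\<close>

definition is_cycle_of :: "('a \<Rightarrow> 'a) \<Rightarrow> 'a list \<Rightarrow> bool"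
  where "is_cycle_of \<sigma> xs \<longleftrightarrow> xs \<noteq> [] \<and> distinct xs \<and> map \<sigma> xs = rotate1 xs"

lemma cyc_eqI:
  assumes "is_cycle_of \<sigma> (p # xs)"
  shows "cyc \<sigma> p = p # xs"
proof -
  let ?ys = "p # xs"
  have step: "\<sigma> (?ys ! j) = ?ys ! (Suc j mod length ?ys)" if "j < length ?ys" for j
  proof -
    have "map \<sigma> ?ys ! j = rotate1 ?ys ! j" using assms unfolding is_cycle_of_def by metis
    then show ?thesis using that by (simp add: nth_rotate1 del: rotate1.simps list.map)
  qed
  have pw: "(\<sigma> ^^ j) p = ?ys ! j" if "j < length ?ys" for j
    using that
  proof (induction j)
    case (Suc j)
    then have "(\<sigma> ^^ Suc j) p = \<sigma> (?ys ! j)" by simp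
    also have "\<dots> = ?ys ! (Suc j mod length ?ys)" using Suc.prems step by simp
    finally show ?case using Suc.prems by simp
  qed simp
  have "(\<sigma> ^^ length ?ys) p = \<sigma> (?ys ! (length xs))" using pw[of "length xs"] by simp
  also have "\<dots> = p" using step[of "length xs"] by simp
  finally have period: "(\<sigma> ^^ length ?ys) p = p" .
  have "least_power \<sigma> p = length ?ys"
    unfolding least_power_def
  proof (rule Least_equality)
    show "(\<sigma> ^^ length ?ys) p = p \<and> 0 < length ?ys" using period by simp
    fix k assume k: "(\<sigma> ^^ k) p = p \<and> 0 < k"
    show "length ?ys \<le> k"
    proof (rule ccontr)
      assume "\<not> length ?ys \<le> k"
      then have "?ys ! k = ?ys ! 0" using pw[of k] k by simp
      then show False
        using assms k \<open>\<not> length ?ys \<le> k\<close> unfolding is_cycle_of_def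
        by (metis length_pos_if_in_set list.set_intros(1) not_le nth_eq_iff_index_eq order_less_irrefl)
    qed
  qed
  then show ?thesis
    unfolding cyc_def by (intro nth_equalityI) (simp_all add: pw del: length_Cons upt_Suc)
qed

lemma is_cycle_of_cyc:
  assumes "permutation \<sigma>"
  shows "is_cycle_of \<sigma> (cyc \<sigma> p)"
proof -
  obtain l where l: "least_power \<sigma> p = Suc l"
    using least_power_of_permutation(2)[OF assms] by (metis gr0_conv_Suc)
  have per: "(\<sigma> ^^ Suc l) p = p"
    using least_power_of_permutation(1)[OF assms, of p] l by simp
  have "cyc \<sigma> p = p # map (\<lambda>j. (\<sigma> ^^ j) p) [1..<Suc l]"
    unfolding cyc_def l by (simp add: upt_conv_Cons del: upt_Suc)
  moreover have "map \<sigma> (cyc \<sigma> p) = map (\<lambda>j. (\<sigma> ^^ j) p) (map Suc [0..<Suc l])"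
    unfolding cyc_def l by simp
  moreover have "\<dots> = map (\<lambda>j. (\<sigma> ^^ j) p) [1..<Suc l] @ [p]"
    unfolding map_Suc_upt using per by simp
  ultimately show ?thesis
    unfolding is_cycle_of_def using cycle_of_permutation[OF assms, of p]
    by (simp add: cyc_def del: upt_Suc funpow.simps)
qed

lemma cyc_Cons:
  assumes "permutation \<sigma>"
  obtains xs where "cyc \<sigma> p = p # xs" "is_cycle_of \<sigma> (p # xs)"
proof -
  have "hd (cyc \<sigma> p) = p" "cyc \<sigma> p \<noteq> []"
    using least_power_of_permutation(2)[OF assms, of p] by (auto simp: cyc_def hd_map upt_conv_Cons)
  then obtain xs where "cyc \<sigma> p = p # xs" by (metis list.collapse)
  with is_cycle_of_cyc[OF assms, of p] that show thesis by metis
qed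

lemma is_cycle_of_rotate:
  assumes "is_cycle_of \<sigma> (us @ vs)"
  shows "is_cycle_of \<sigma> (vs @ us)"
proof -
  have "rotate1 (rotate (length us) (us @ vs)) = rotate (length us) (rotate1 (us @ vs))"
    by (simp add: rotate1_rotate_swap del: rotate_append)
  also have "\<dots> = map \<sigma> (rotate (length us) (us @ vs))"
    using assms unfolding is_cycle_of_def by (metis rotate_map)
  finally show ?thesis
    using assms unfolding is_cycle_of_def rotate_append by auto
qed

lemma self_in_orb:
  assumes "permutation \<sigma>"
  shows "p \<in> orb \<sigma> p"
  using cyc_Cons[OF assms, of p] by (metis list.set_intros(1))

lemma cyc_rotated:
  assumes "permutation \<sigma>" "q \<in> orb \<sigma> p"
  obtains us vs where "cyc \<sigma> p = us @ q # vs" "cyc \<sigma> q = q # vs @ us"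
proof -
  obtain us vs where uv: "cyc \<sigma> p = us @ q # vs" using assms(2) by (metis split_list)
  have "is_cycle_of \<sigma> ((q # vs) @ us)"
    using is_cycle_of_cyc[OF assms(1), of p] unfolding uv by (rule is_cycle_of_rotate)
  then have "cyc \<sigma> q = q # vs @ us" by (simp add: cyc_eqI)
  with uv that show thesis by blast
qed

lemma orb_eq:
  assumes "permutation \<sigma>" "q \<in> orb \<sigma> p"
  shows "orb \<sigma> q = orb \<sigma> p"
  by (rule cyc_rotated[OF assms]) auto

lemma orb_eq_iff:
  assumes "permutation \<sigma>"
  shows "orb \<sigma> q = orb \<sigma> p \<longleftrightarrow> q \<in> orb \<sigma> p"
  using orb_eq[OF assms] self_in_orb[OF assms] by blast

lemma image_orb:
  assumes "permutation \<sigma>"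
  shows "\<sigma> ` orb \<sigma> p = orb \<sigma> p"
proof -
  have "set (map \<sigma> (cyc \<sigma> p)) = set (rotate1 (cyc \<sigma> p))"
    using is_cycle_of_cyc[OF assms, of p] unfolding is_cycle_of_def by simp
  then show ?thesis by simp
qed

lemma apply_in_orb_iff:
  assumes "permutation \<sigma>"
  shows "\<sigma> x \<in> orb \<sigma> p \<longleftrightarrow> x \<in> orb \<sigma> p"
proof -
  have "inj \<sigma>" using assms by (simp add: permutation_bijective bij_is_inj)
  then show ?thesis using image_orb[OF assms, of p] by (metis inj_image_mem_iff)
qed

lemma inv_apply_in_orb_iff:
  assumes "permutation \<sigma>"
  shows "inv_into UNIV \<sigma> x \<in> orb \<sigma> p \<longleftrightarrow> x \<in> orb \<sigma> p"
  using apply_in_orb_iff[OF assms, of "inv_into UNIV \<sigma> x" p] assms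
  by (simp add: permutation_bijective bij_is_surj surj_f_inv_f)

lemma orb_subset:
  assumes "\<sigma> permutes S" "finite S" "p \<in> S"
  shows "orb \<sigma> p \<subseteq> S"
proof -
  have "(\<sigma> ^^ j) p \<in> S" for j
    using permutes_in_image[OF permutes_funpow[OF assms(1)], of j p] assms(3) by simp
  then show ?thesis by (auto simp: cyc_def)
qed

text \<open>The permutation that runs through the cycle of \<open>m\<close> backwards and is unchanged elsewhere.
Averaging over such reversals is what turns cycle products of Hermitian matrices into reals.\<close>

definition reverse_cycle :: "('a \<Rightarrow> 'a) \<Rightarrow> 'a \<Rightarrow> 'a \<Rightarrow> 'a"
  where "reverse_cycle \<sigma> m x = (if x \<in> orb \<sigma> m then inv_into UNIV \<sigma> x else \<sigma> x)"

lemma reverse_cyc_other: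
  assumes "permutation \<sigma>" "x \<notin> orb \<sigma> m"
  shows "cyc (reverse_cycle \<sigma> m) x = cyc \<sigma> x"
proof -
  obtain xs where xs: "cyc \<sigma> x = x # xs" "is_cycle_of \<sigma> (x # xs)" by (rule cyc_Cons[OF assms(1)])
  have "y \<notin> orb \<sigma> m" if "y \<in> orb \<sigma> x" for y
    using that assms orb_eq[OF assms(1)] self_in_orb[OF assms(1)] by blast
  then have "map (reverse_cycle \<sigma> m) (x # xs) = map \<sigma> (x # xs)"
    unfolding xs(1) by (auto simp: reverse_cycle_def)
  then have "is_cycle_of (reverse_cycle \<sigma> m) (x # xs)"
    using xs(2) unfolding is_cycle_of_def by metis
  then show ?thesis using xs(1) by (simp add: cyc_eqI)
qed

lemma reverse_cyc_same:
  assumes "permutation \<sigma>" "cyc \<sigma> m = m # xs"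
  shows "cyc (reverse_cycle \<sigma> m) m = m # rev xs"
proof -
  have c: "is_cycle_of \<sigma> (m # xs)" using is_cycle_of_cyc[OF assms(1), of m] assms(2) by simp
  have "inj \<sigma>" using assms(1) by (simp add: permutation_bijective bij_is_inj)
  then have inv: "map (inv_into UNIV \<sigma>) (map \<sigma> ys) = ys" for ys by (simp add: o_def)
  have "map (inv_into UNIV \<sigma>) (rotate1 (m # xs)) = m # xs"
    using c inv[of "m # xs"] unfolding is_cycle_of_def by simp
  then have "rev (map (inv_into UNIV \<sigma>) (xs @ [m])) = rev xs @ [m]" by simp
  then have "map (inv_into UNIV \<sigma>) (m # rev xs) = rev xs @ [m]" by (simp add: rev_map)
  moreover have "map (reverse_cycle \<sigma> m) (m # rev xs) = map (inv_into UNIV \<sigma>) (m # rev xs)"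
    by (auto simp: reverse_cycle_def assms(2))
  ultimately have "is_cycle_of (reverse_cycle \<sigma> m) (m # rev xs)"
    using c by (simp add: is_cycle_of_def)
  then show ?thesis by (rule cyc_eqI)
qed

lemma permutes_reverse:
  assumes "\<sigma> permutes S" "finite S"
  shows "reverse_cycle \<sigma> m permutes S"
proof -
  have p: "permutation \<sigma>" using assms permutation_permutes by blast
  have "inj (reverse_cycle \<sigma> m)"
  proof (rule injI)
    fix x y assume "reverse_cycle \<sigma> m x = reverse_cycle \<sigma> m y"
    then show "x = y"
      using apply_in_orb_iff[OF p] inv_apply_in_orb_iff[OF p] permutes_inj[OF assms(1)]
        permutes_inj[OF permutes_inv[OF assms(1)]]
      by (auto simp: reverse_cycle_def inj_eq split: if_splits; metis)
  qed
  moreover have "reverse_cycle \<sigma> m x \<in> S" if "x \<in> S" for x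
    using that permutes_in_image[OF assms(1)] permutes_in_image[OF permutes_inv[OF assms(1)]]
    by (simp add: reverse_cycle_def)
  moreover have "reverse_cycle \<sigma> m x = x" if "x \<notin> S" for x
    using that assms(1) permutes_inv[OF assms(1)] by (simp add: reverse_cycle_def permutes_not_in)
  ultimately show ?thesis
    using assms(2) by (intro inj_imp_permutes) (auto intro: inj_on_subset)
qed

lemma orb_reverse:
  assumes "permutation \<sigma>" "permutation (reverse_cycle \<sigma> m)"
  shows "orb (reverse_cycle \<sigma> m) x = orb \<sigma> x"
proof (cases "x \<in> orb \<sigma> m")
  case True
  obtain xs where xs: "cyc \<sigma> m = m # xs" by (rule cyc_Cons[OF assms(1)])
  have m: "orb (reverse_cycle \<sigma> m) m = orb \<sigma> m" using reverse_cyc_same[OF assms(1) xs] xs by simp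
  then show ?thesis using True orb_eq[OF assms(1)] orb_eq[OF assms(2), of x m] by simp
next
  case False
  then show ?thesis using reverse_cyc_other[OF assms(1)] by simp
qed

lemma reverse_reverse:
  assumes "permutation \<sigma>" "permutation (reverse_cycle \<sigma> m)"
  shows "reverse_cycle (reverse_cycle \<sigma> m) m = \<sigma>"
proof
  fix x
  show "reverse_cycle (reverse_cycle \<sigma> m) m x = \<sigma> x"
  proof (cases "x \<in> orb \<sigma> m")
    case True
    have "reverse_cycle \<sigma> m (\<sigma> x) = x"
      using True assms(1) apply_in_orb_iff[OF assms(1), of x m]
      by (simp add: reverse_cycle_def permutation_bijective bij_is_inj)
    moreover have "inj (reverse_cycle \<sigma> m)" using assms(2) by (simp add: permutation_bijective bij_is_inj)
    ultimately have "inv_into UNIV (reverse_cycle \<sigma> m) x = \<sigma> x" by (metis inv_f_f)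
    then show ?thesis using True orb_reverse[OF assms, of m] by (subst reverse_cycle_def) simp
  next
    case False
    then show ?thesis using orb_reverse[OF assms, of m] by (simp add: reverse_cycle_def[of "reverse_cycle \<sigma> m"] reverse_cycle_def[of \<sigma>])
  qed
qed

section \<open>Quaternionic products along cycles\<close>

lemma qcnj_mult: "qcnj (p * q) = qcnj q * qcnj p"
  by (simp add: qcnj_def times_quat_def)

lemma qcnj_qcnj [simp]: "qcnj (qcnj q) = q"
  by (simp add: qcnj_def)

lemma q0_mult_commute: "q0 (p * q) = q0 (q * p)"
  by (simp add: times_quat_def)

lemma q0_qcnj [simp]: "q0 (qcnj q) = q0 q"
  by (simp add: qcnj_def)

lemma q0_add: "q0 (p + q) = q0 p + q0 q"
  by (simp add: plus_quat_def)

lemma q0_zero [simp]: "q0 0 = 0"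
  by (simp add: zero_quat_def)

lemma quat_of_real: "of_real r = Quat r 0 0 0"
  by (simp add: of_real_def scaleR_quat_def one_quat_def)

text \<open>The source of all real values below: a quaternion and its conjugate add up to a real.\<close>

lemma add_qcnj: "q + qcnj q = of_real (q0 q) + of_real (q0 q)"
  by (cases q) (simp add: qcnj_def plus_quat_def quat_of_real)

lemma of_real_mult_commute: "of_real r * q = q * (of_real r :: quat)"
  by (simp add: of_real_def)

lemma double_eq_iff: "x + x = y + y \<longleftrightarrow> x = (y :: 'a :: real_vector)"
  by (metis scaleR_2 scaleR_cancel_left zero_neq_numeral)

text \<open>Averaging over an involution. With \<open>\<phi>\<close> a cycle reversal, it replaces one cycle product
by its real part in a whole signed sum, although no single term is real.\<close>

lemma sum_involution:
  fixes T U :: "'a \<Rightarrow> 'b :: real_vector"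
  assumes "\<And>s. s \<in> G \<Longrightarrow> \<phi> s \<in> G" "\<And>s. s \<in> G \<Longrightarrow> \<phi> (\<phi> s) = s"
    and "\<And>s. s \<in> G \<Longrightarrow> T s + T (\<phi> s) = U s + U s"
  shows "sum T G = sum U G"
proof -
  have "sum T G = (\<Sum>s\<in>G. T (\<phi> s))"
    by (rule sum.reindex_bij_witness[of _ \<phi> \<phi>]) (use assms in auto)
  then have "sum T G + sum T G = (\<Sum>s\<in>G. T s + T (\<phi> s))" by (simp add: sum.distrib)
  also have "\<dots> = (\<Sum>s\<in>G. U s + U s)" using assms(3) by (intro sum.cong) auto
  also have "\<dots> = sum U G + sum U G" by (simp add: sum.distrib)
  finally show ?thesis by (simp only: double_eq_iff)
qed

text \<open>The product of the entries along the walk from \<open>x\<close> through the listed vertices to \<open>y\<close>. In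
contrast to a product indexed by \<open>q\<close> and \<open>\<sigma> q\<close>, it does not mention a permutation, so it can be
cut, joined and reversed when the permutation changes.\<close>

fun path :: "('a \<Rightarrow> 'a \<Rightarrow> 'b :: monoid_mult) \<Rightarrow> 'a \<Rightarrow> 'a list \<Rightarrow> 'a \<Rightarrow> 'b" where
  "path e x [] y = e x y"
| "path e x (z # zs) y = e x z * path e z zs y"

lemma path_append: "path e x (us @ z # vs) y = path e x us z * path e z vs y"
  by (induction us arbitrary: x) (simp_all add: mult.assoc)

definition hermitian_on :: "'a set \<Rightarrow> ('a \<Rightarrow> 'a \<Rightarrow> quat) \<Rightarrow> bool"
  where "hermitian_on X e \<longleftrightarrow> (\<forall>p\<in>X. \<forall>q\<in>X. qcnj (e p q) = e q p)"

lemma qcnj_path: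
  assumes "hermitian_on X e" "x \<in> X" "y \<in> X" "set zs \<subseteq> X"
  shows "qcnj (path e x zs y) = path e y (rev zs) x"
  using assms(2,4)
proof (induction zs arbitrary: x)
  case Nil
  then show ?case using assms(1,3) by (simp add: hermitian_on_def)
next
  case (Cons z zs)
  then have "qcnj (e x z) = e z x" using assms(1) by (simp add: hermitian_on_def)
  with Cons show ?case by (simp add: qcnj_mult path_append)
qed

lemma prod_list_eq_path:
  assumes "map \<sigma> (x # xs) = xs @ [y]"
  shows "prod_list (map (\<lambda>q. e q (\<sigma> q)) (x # xs)) = path e x xs y"
  using assms
proof (induction xs arbitrary: x)
  case (Cons z zs)
  then have "prod_list (map (\<lambda>q. e q (\<sigma> q)) (z # zs)) = path e z zs y" by auto
  then show ?case using Cons.prems by auto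
qed simp

definition cycle_weight :: "('a \<Rightarrow> 'a \<Rightarrow> quat) \<Rightarrow> ('a \<Rightarrow> 'a) \<Rightarrow> 'a \<Rightarrow> quat"
  where "cycle_weight e \<sigma> p = prod_list (map (\<lambda>q. e q (\<sigma> q)) (cyc \<sigma> p))"

lemma cycle_weight_eq_path:
  assumes "permutation \<sigma>" "cyc \<sigma> p = p # xs"
  shows "cycle_weight e \<sigma> p = path e p xs p"
proof -
  have "map \<sigma> (p # xs) = xs @ [p]"
    using is_cycle_of_cyc[OF assms(1), of p] assms(2) by (simp add: is_cycle_of_def)
  then show ?thesis unfolding cycle_weight_def assms(2) by (rule prod_list_eq_path)
qed

text \<open>The starting point of a cycle only conjugates its product cyclically, and real parts satisfy
\<open>Re (a b) = Re (b a)\<close>; so the real part belongs to the cycle itself.\<close>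

lemma q0_cycle_weight_cong:
  assumes "permutation \<sigma>" "q \<in> orb \<sigma> p"
  shows "q0 (cycle_weight e \<sigma> q) = q0 (cycle_weight e \<sigma> p)"
proof -
  obtain us vs where "cyc \<sigma> p = us @ q # vs" "cyc \<sigma> q = (q # vs) @ us"
    using cyc_rotated[OF assms] by (metis append_Cons)
  then show ?thesis by (simp only: cycle_weight_def map_append prod_list.append q0_mult_commute)
qed

text \<open>For a Hermitian matrix the reversed walk uses the conjugated entries in the opposite order, which
is the conjugate of the product. The set \<open>X\<close> is there to leave out a row that has been
overwritten.\<close>

lemma cycle_weight_reverse_same:
  assumes "permutation \<sigma>" "permutation (reverse_cycle \<sigma> m)" "hermitian_on X e" "orb \<sigma> m \<subseteq> X"
  shows "cycle_weight e (reverse_cycle \<sigma> m) m = qcnj (cycle_weight e \<sigma> m)"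
proof -
  obtain xs where xs: "cyc \<sigma> m = m # xs" by (rule cyc_Cons[OF assms(1)])
  have "cycle_weight e (reverse_cycle \<sigma> m) m = path e m (rev xs) m"
    by (rule cycle_weight_eq_path[OF assms(2) reverse_cyc_same[OF assms(1) xs]])
  also have "\<dots> = qcnj (path e m xs m)"
    using assms(4) xs by (intro qcnj_path[OF assms(3), symmetric]) auto
  finally show ?thesis using cycle_weight_eq_path[OF assms(1) xs] by simp
qed

lemma cycle_weight_reverse_other:
  assumes "permutation \<sigma>" "x \<notin> orb \<sigma> m"
  shows "cycle_weight e (reverse_cycle \<sigma> m) x = cycle_weight e \<sigma> x"
proof -
  have "reverse_cycle \<sigma> m y = \<sigma> y" if "y \<in> orb \<sigma> x" for y
  proof -
    have "y \<notin> orb \<sigma> m"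
      using that assms orb_eq[OF assms(1)] self_in_orb[OF assms(1)] by blast
    then show ?thesis by (simp add: reverse_cycle_def)
  qed
  then show ?thesis
    unfolding cycle_weight_def reverse_cyc_other[OF assms] by (intro arg_cong[of _ _ prod_list] map_cong) simp_all
qed

section \<open>The terms of a row determinant\<close>

definition cycles :: "nat \<Rightarrow> (nat \<Rightarrow> nat) \<Rightarrow> nat set set"
  where "cycles n \<sigma> = orb \<sigma> ` {0..<n}"

definition cycles_sign :: "nat \<Rightarrow> (nat \<Rightarrow> nat) \<Rightarrow> real"
  where "cycles_sign n \<sigma> = (- 1) ^ (n - card (cycles n \<sigma>))"

text \<open>The minimum is merely a canonical representative; by \<open>real_weight_orb\<close> every element of the cycle
gives the same value.\<close>

definition real_weight :: "(nat \<Rightarrow> nat \<Rightarrow> quat) \<Rightarrow> (nat \<Rightarrow> nat) \<Rightarrow> nat set \<Rightarrow> real"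
  where "real_weight e \<sigma> C = q0 (cycle_weight e \<sigma> (Min C))"

text \<open>The first elements of the cycles that do not contain \<open>i\<close>, which is where the row determinant starts
reading these cycles.\<close>

definition heads :: "nat \<Rightarrow> nat \<Rightarrow> (nat \<Rightarrow> nat) \<Rightarrow> nat set"
  where "heads n i \<sigma> = {p. p < n \<and> i \<notin> orb \<sigma> p \<and> p = Min (orb \<sigma> p)}"

abbreviation perms :: "nat \<Rightarrow> (nat \<Rightarrow> nat) set"
  where "perms n \<equiv> {\<sigma>. \<sigma> permutes {0..<n}}"

lemma permutation_if_permutes: "\<sigma> permutes {0..<n::nat} \<Longrightarrow> permutation \<sigma>"
  using permutation_permutes by blast

lemma finite_heads [simp]: "finite (heads n i \<sigma>)"
  by (simp add: heads_def)

lemma finite_cycles [simp]: "finite (cycles n \<sigma>)"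
  by (simp add: cycles_def)

lemma Min_orb_in:
  assumes "permutation \<sigma>"
  shows "Min (orb \<sigma> p) \<in> orb \<sigma> p"
  using self_in_orb[OF assms, of p] by (intro Min_in) auto

lemma real_weight_orb:
  assumes "permutation \<sigma>" "q \<in> orb \<sigma> p"
  shows "real_weight e \<sigma> (orb \<sigma> p) = q0 (cycle_weight e \<sigma> q)"
  unfolding real_weight_def
  using q0_cycle_weight_cong[OF assms(1) Min_orb_in[OF assms(1)], of e p] q0_cycle_weight_cong[OF assms, of e]
  by simp

lemma reverse_in_perms: "\<sigma> \<in> perms n \<Longrightarrow> reverse_cycle \<sigma> m \<in> perms n"
  using permutes_reverse[of \<sigma> "{0..<n}" m] by simp

lemma perms_reverse_simps:
  assumes "\<sigma> \<in> perms n"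
  shows "orb (reverse_cycle \<sigma> m) x = orb \<sigma> x" "reverse_cycle (reverse_cycle \<sigma> m) m = \<sigma>"
    "cycles n (reverse_cycle \<sigma> m) = cycles n \<sigma>" "cycles_sign n (reverse_cycle \<sigma> m) = cycles_sign n \<sigma>"
    "heads n i (reverse_cycle \<sigma> m) = heads n i \<sigma>"
proof -
  have p: "permutation \<sigma>" "permutation (reverse_cycle \<sigma> m)"
    using assms reverse_in_perms[OF assms, of m] permutation_if_permutes by auto
  show o: "orb (reverse_cycle \<sigma> m) x = orb \<sigma> x" for x by (rule orb_reverse[OF p])
  show "reverse_cycle (reverse_cycle \<sigma> m) m = \<sigma>" by (rule reverse_reverse[OF p])
  show c: "cycles n (reverse_cycle \<sigma> m) = cycles n \<sigma>" by (simp add: cycles_def o)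
  show "cycles_sign n (reverse_cycle \<sigma> m) = cycles_sign n \<sigma>" by (simp add: cycles_sign_def c)
  show "heads n i (reverse_cycle \<sigma> m) = heads n i \<sigma>" by (simp add: heads_def o)
qed

lemma heads_transversal:
  assumes "\<sigma> \<in> perms n"
  shows "bij_betw (orb \<sigma>) (heads n i \<sigma>) (cycles n \<sigma> - {orb \<sigma> i})"
proof (rule bij_betw_imageI)
  have p: "permutation \<sigma>" using assms permutation_if_permutes by simp
  show "inj_on (orb \<sigma>) (heads n i \<sigma>)" 
  proof (rule inj_onI)
    fix p q assume "p \<in> heads n i \<sigma>" "q \<in> heads n i \<sigma>" and eq: "orb \<sigma> p = orb \<sigma> q"
    then have "p = Min (orb \<sigma> p)" "q = Min (orb \<sigma> q)" by (simp_all only: heads_def mem_Collect_eq)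
    then show "p = q" using eq by (simp only:)
  qed
  show "orb \<sigma> ` heads n i \<sigma> = cycles n \<sigma> - {orb \<sigma> i}"
  proof (intro equalityI subsetI)
    fix C assume "C \<in> orb \<sigma> ` heads n i \<sigma>"
    then show "C \<in> cycles n \<sigma> - {orb \<sigma> i}"
      using self_in_orb[OF p, of i] by (auto simp: heads_def cycles_def)
  next
    fix C assume C: "C \<in> cycles n \<sigma> - {orb \<sigma> i}"
    then have "C \<in> orb \<sigma> ` {0..<n}" by (simp only: cycles_def Diff_iff)
    then obtain p where p': "p < n" "C = orb \<sigma> p" by (elim imageE) simp
    let ?m = "Min (orb \<sigma> p)"
    have m: "?m \<in> orb \<sigma> p" by (rule Min_orb_in[OF p])
    have "?m < n" using orb_subset[of \<sigma> "{0..<n}" p] m p'(1) assms by auto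
    moreover have "orb \<sigma> ?m = C" using orb_eq[OF p m] p'(2) by simp
    moreover have "i \<notin> C" using C p'(2) orb_eq[OF p] by blast
    ultimately have "?m \<in> heads n i \<sigma>" by (simp add: heads_def p'(2))
    then show "C \<in> orb \<sigma> ` heads n i \<sigma>" using \<open>orb \<sigma> ?m = C\<close> by blast
  qed
qed

lemma card_heads:
  assumes "\<sigma> \<in> perms n" "i < n"
  shows "Suc (card (heads n i \<sigma>)) = card (cycles n \<sigma>)"
proof -
  have "orb \<sigma> i \<in> cycles n \<sigma>" using assms(2) by (simp add: cycles_def)
  then show ?thesis
    using bij_betw_same_card[OF heads_transversal[OF assms(1), of i]] card_Suc_Diff1[OF finite_cycles]
    by simp
qed

lemma prod_heads:
  assumes "\<sigma> \<in> perms n"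
  shows "(\<Prod>h\<in>heads n i \<sigma>. q0 (cycle_weight e \<sigma> h)) = prod (real_weight e \<sigma>) (cycles n \<sigma> - {orb \<sigma> i})"
proof -
  have "q0 (cycle_weight e \<sigma> h) = real_weight e \<sigma> (orb \<sigma> h)" for h
  proof -
    have "permutation \<sigma>" using assms permutation_if_permutes by simp
    then show ?thesis by (rule real_weight_orb[OF _ self_in_orb, symmetric]) fact
  qed
  then show ?thesis using prod.reindex_bij_betw[OF heads_transversal[OF assms]] by simp
qed

lemma rdet_eq:
  assumes "A \<in> carrier_mat n n" "i < n" "\<And>p q. p < n \<Longrightarrow> q < n \<Longrightarrow> e p q = A $$ (p, q)"
  shows "rdet i A = (\<Sum>\<sigma>\<in>perms n. of_real (cycles_sign n \<sigma>) *
    (cycle_weight e \<sigma> i * prod_list (map (cycle_weight e \<sigma>) (sorted_list_of_set (heads n i \<sigma>)))))"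
proof -
  have "(- 1) ^ (n - length (cycle_heads n i \<sigma>)) * prod_list (map (cycle_prod A \<sigma>) (cycle_heads n i \<sigma>)) =
    of_real (cycles_sign n \<sigma>) * (cycle_weight e \<sigma> i * prod_list (map (cycle_weight e \<sigma>) (sorted_list_of_set (heads n i \<sigma>))))"
    if s: "\<sigma> \<in> perms n" for \<sigma>
  proof -
    have h: "cycle_heads n i \<sigma> = i # sorted_list_of_set (heads n i \<sigma>)"
      by (simp add: cycle_heads_def heads_def cyc_def)
    have len: "length (cycle_heads n i \<sigma>) = card (cycles n \<sigma>)"
      using h card_heads[OF s assms(2)] by simp
    have "cycle_prod A \<sigma> h = cycle_weight e \<sigma> h" if "h < n" for h
    proof -
      have "e q (\<sigma> q) = A $$ (q, \<sigma> q)" if "q \<in> orb \<sigma> h" for q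
      proof -
        have "q < n" using that orb_subset[of \<sigma> "{0..<n}" h] s \<open>h < n\<close> by auto
        moreover have "\<sigma> q < n" using s \<open>q < n\<close> permutes_in_image[of \<sigma> "{0..<n}" q] by simp
        ultimately show ?thesis by (rule assms(3))
      qed
      then have "map (\<lambda>q. A $$ (q, \<sigma> q)) (cyc \<sigma> h) = map (\<lambda>q. e q (\<sigma> q)) (cyc \<sigma> h)"
        by (intro map_cong) (simp_all only:)
      then show ?thesis unfolding cycle_prod_def cycle_weight_def cyc_def by (rule arg_cong)
    qed
    moreover have "h < n" if "h \<in> heads n i \<sigma>" for h using that by (simp add: heads_def)
    ultimately have "map (cycle_prod A \<sigma>) (cycle_heads n i \<sigma>) = map (cycle_weight e \<sigma>) (cycle_heads n i \<sigma>)"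
      using assms(2) by (intro map_cong) (auto simp: h)
    then have "prod_list (map (cycle_prod A \<sigma>) (cycle_heads n i \<sigma>)) =
      cycle_weight e \<sigma> i * prod_list (map (cycle_weight e \<sigma>) (sorted_list_of_set (heads n i \<sigma>)))"
      by (simp only: h list.map prod_list.Cons)
    then show ?thesis using len by (simp only: cycles_sign_def) simp
  qed
  moreover have "dim_row A = n" using assms(1) by simp
  ultimately show ?thesis unfolding rdet_def by (intro sum.cong) simp_all
qed

section \<open>Row determinants of Hermitian matrices\<close>

lemma orb_commute:
  assumes "permutation \<sigma>"
  shows "q \<in> orb \<sigma> p \<longleftrightarrow> p \<in> orb \<sigma> q"
  using orb_eq_iff[OF assms] by blast

lemma real_weight_reverse:
  assumes "permutation \<sigma>" "p \<notin> orb \<sigma> m"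
  shows "real_weight e (reverse_cycle \<sigma> m) (orb \<sigma> p) = real_weight e \<sigma> (orb \<sigma> p)"
proof -
  have "orb \<sigma> (Min (orb \<sigma> p)) = orb \<sigma> p" by (rule orb_eq[OF assms(1) Min_orb_in[OF assms(1)]])
  then have "Min (orb \<sigma> p) \<notin> orb \<sigma> m"
    using assms(2) orb_eq[OF assms(1), of _ m] self_in_orb[OF assms(1), of p] by auto
  then show ?thesis by (simp add: real_weight_def cycle_weight_reverse_other[OF assms(1)])
qed

text \<open>If \<open>e\<close> is Hermitian apart from row and column \<open>i\<close>, then all cycles avoiding \<open>i\<close> may be replaced
by their real parts, and their order becomes irrelevant. The real parts are introduced one head at a
time: reversing the cycle headed by \<open>m\<close> conjugates its product and changes neither the heads
nor the other factors, so the average over both orientations contains the real part.\<close>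

lemma rdet_real_weights:
  assumes A: "A \<in> carrier_mat n n" and i: "i < n"
    and e: "\<And>p q. p < n \<Longrightarrow> q < n \<Longrightarrow> e p q = A $$ (p, q)"
    and herm: "hermitian_on ({0..<n} - {i}) e"
  shows "rdet i A = (\<Sum>\<sigma>\<in>perms n. of_real (cycles_sign n \<sigma>) *
    (cycle_weight e \<sigma> i * of_real (prod (real_weight e \<sigma>) (cycles n \<sigma> - {orb \<sigma> i}))))"
proof -
  \<comment> \<open>the state after the heads below \<open>m\<close> have been treated\<close>
  define w where "w m \<sigma> h = (if h < m then of_real (q0 (cycle_weight e \<sigma> h)) else cycle_weight e \<sigma> h)" for m \<sigma> h
  define T where "T m \<sigma> = of_real (cycles_sign n \<sigma>) *
    (cycle_weight e \<sigma> i * prod_list (map (w m \<sigma>) (sorted_list_of_set (heads n i \<sigma>))))" for m \<sigma>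
  have step: "sum (T m) (perms n) = sum (T (Suc m)) (perms n)" for m
  proof (rule sum_involution[where \<phi> = "\<lambda>\<sigma>. if m \<in> heads n i \<sigma> then reverse_cycle \<sigma> m else \<sigma>"])
    fix \<sigma> assume s: "\<sigma> \<in> perms n"
    then show "(if m \<in> heads n i \<sigma> then reverse_cycle \<sigma> m else \<sigma>) \<in> perms n"
      using reverse_in_perms[OF s] by simp
    show "(if m \<in> heads n i (if m \<in> heads n i \<sigma> then reverse_cycle \<sigma> m else \<sigma>)
        then reverse_cycle (if m \<in> heads n i \<sigma> then reverse_cycle \<sigma> m else \<sigma>) m
        else (if m \<in> heads n i \<sigma> then reverse_cycle \<sigma> m else \<sigma>)) = \<sigma>"
      by (simp add: perms_reverse_simps[OF s])
    show "T m \<sigma> + T m (if m \<in> heads n i \<sigma> then reverse_cycle \<sigma> m else \<sigma>) = T (Suc m) \<sigma> + T (Suc m) \<sigma>"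
    proof (cases "m \<in> heads n i \<sigma>")
      case False
      have "map (w m \<sigma>) (sorted_list_of_set (heads n i \<sigma>)) = map (w (Suc m) \<sigma>) (sorted_list_of_set (heads n i \<sigma>))"
        using False by (auto simp: w_def less_Suc_eq)
      then show ?thesis using False by (simp only: T_def if_False)
    next
      case True
      let ?\<tau> = "reverse_cycle \<sigma> m" and ?L = "sorted_list_of_set (heads n i \<sigma>)"
      have p: "permutation \<sigma>" "permutation ?\<tau>"
        using s reverse_in_perms[OF s] permutation_if_permutes by auto
      have "m \<in> set ?L" using True by simp
      then obtain us vs where L: "?L = us @ m # vs" by (metis split_list)
      have "distinct ?L" by simp
      then have uvs: "set us \<union> set vs = heads n i \<sigma> - {m}"
        using set_sorted_list_of_set[OF finite_heads, of n i \<sigma>] unfolding L by auto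
      \<comment> \<open>distinct heads lie on distinct cycles, because a head is the minimum of its cycle\<close>
      have off: "h \<notin> orb \<sigma> m" if "h \<in> set us \<union> set vs" for h
      proof
        assume "h \<in> orb \<sigma> m"
        then have "orb \<sigma> h = orb \<sigma> m" by (rule orb_eq[OF p(1)])
        moreover have "h = Min (orb \<sigma> h)" "m = Min (orb \<sigma> m)" "h \<noteq> m"
          using that True unfolding uvs by (simp_all add: heads_def)
        ultimately show False by simp
      qed
      have wu: "map (w m ?\<tau>) us = map (w m \<sigma>) us" "map (w (Suc m) \<sigma>) us = map (w m \<sigma>) us"
        and wv: "map (w m ?\<tau>) vs = map (w m \<sigma>) vs" "map (w (Suc m) \<sigma>) vs = map (w m \<sigma>) vs"
      proof -
        have "h \<noteq> m" "cycle_weight e ?\<tau> h = cycle_weight e \<sigma> h" if "h \<in> set us \<union> set vs" for h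
          using that uvs cycle_weight_reverse_other[OF p(1) off[OF that]] by auto
        then show "map (w m ?\<tau>) us = map (w m \<sigma>) us" "map (w (Suc m) \<sigma>) us = map (w m \<sigma>) us"
          "map (w m ?\<tau>) vs = map (w m \<sigma>) vs" "map (w (Suc m) \<sigma>) vs = map (w m \<sigma>) vs"
          unfolding w_def by (auto simp: less_Suc_eq)
      qed
      have im: "i \<notin> orb \<sigma> m" using True by (simp add: heads_def)
      have "m < n" using True by (simp add: heads_def)
      then have "orb \<sigma> m \<subseteq> {0..<n} - {i}" using orb_subset[of \<sigma> "{0..<n}" m] s im by auto
      then have cm: "cycle_weight e ?\<tau> m = qcnj (cycle_weight e \<sigma> m)"
        by (rule cycle_weight_reverse_same[OF p herm])
      have ci: "cycle_weight e ?\<tau> i = cycle_weight e \<sigma> i" by (rule cycle_weight_reverse_other[OF p(1) im])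
      have wm: "w m \<sigma> m = cycle_weight e \<sigma> m" "w m ?\<tau> m = qcnj (cycle_weight e \<sigma> m)"
        "w (Suc m) \<sigma> m = of_real (q0 (cycle_weight e \<sigma> m))"
        using cm by (simp_all add: w_def)
      define a where "a = prod_list (map (w m \<sigma>) us)"
      define b where "b = prod_list (map (w m \<sigma>) vs)"
      define c where "c = of_real (cycles_sign n \<sigma>) * cycle_weight e \<sigma> i"
      define x where "x = cycle_weight e \<sigma> m"
      have "T m \<sigma> = c * (a * x * b)"
        unfolding T_def L c_def a_def b_def x_def by (simp add: wm mult.assoc)
      moreover have "T m ?\<tau> = c * (a * qcnj x * b)"
        unfolding T_def perms_reverse_simps[OF s] L c_def a_def b_def x_def by (simp add: wm wu wv ci mult.assoc)
      moreover have "T (Suc m) \<sigma> = c * (a * of_real (q0 x) * b)"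
        unfolding T_def L c_def a_def b_def x_def by (simp add: wm wu wv mult.assoc)
      moreover have "c * (a * x * b) + c * (a * qcnj x * b) = c * (a * (x + qcnj x) * b)"
        by (simp add: algebra_simps)
      moreover have "\<dots> = c * (a * of_real (q0 x) * b) + c * (a * of_real (q0 x) * b)"
        unfolding add_qcnj by (simp add: algebra_simps)
      ultimately show ?thesis using True by simp
    qed
  qed
  have w0: "w 0 \<sigma> = cycle_weight e \<sigma>" for \<sigma> by (simp add: w_def fun_eq_iff)
  have "rdet i A = (\<Sum>\<sigma>\<in>perms n. T 0 \<sigma>)"
    using rdet_eq[OF A i, of e] e by (simp only: T_def w0)
  also have "sum (T 0) (perms n) = sum (T m) (perms n)" for m
  proof (induction m)
    case (Suc m)
    then show ?case using step[of m] by (rule trans)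
  qed (rule refl)
  also have "sum (T n) (perms n) = (\<Sum>\<sigma>\<in>perms n. of_real (cycles_sign n \<sigma>) *
    (cycle_weight e \<sigma> i * of_real (prod (real_weight e \<sigma>) (cycles n \<sigma> - {orb \<sigma> i}))))"
  proof (rule sum.cong[OF refl])
    fix \<sigma> assume s: "\<sigma> \<in> perms n"
    have "map (w n \<sigma>) (sorted_list_of_set (heads n i \<sigma>)) =
      map (\<lambda>h. of_real (q0 (cycle_weight e \<sigma> h))) (sorted_list_of_set (heads n i \<sigma>))"
      by (auto simp: w_def heads_def)
    moreover have "prod_list (map (\<lambda>h. of_real (f h)) hs) = (of_real (prod_list (map f hs)) :: quat)"
      for f :: "nat \<Rightarrow> real" and hs by (induction hs) simp_all
    moreover have "prod_list (map f (sorted_list_of_set (heads n i \<sigma>))) = prod f (heads n i \<sigma>)"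
      for f :: "nat \<Rightarrow> real"
      using prod.distinct_set_conv_list[of "sorted_list_of_set (heads n i \<sigma>)" f] by simp
    ultimately show "T n \<sigma> = of_real (cycles_sign n \<sigma>) *
      (cycle_weight e \<sigma> i * of_real (prod (real_weight e \<sigma>) (cycles n \<sigma> - {orb \<sigma> i})))"
      unfolding T_def prod_heads[OF s, symmetric] by (simp only:)
  qed
  finally show ?thesis .
qed

text \<open>The Moore determinant of a Hermitian matrix in a form that is visibly real and independent of any row:
the signed sum of the products of the real parts of the cycle products.\<close>

definition moore_det :: "nat \<Rightarrow> (nat \<Rightarrow> nat \<Rightarrow> quat) \<Rightarrow> real"
  where "moore_det n e = (\<Sum>\<sigma>\<in>perms n. cycles_sign n \<sigma> * prod (real_weight e \<sigma>) (cycles n \<sigma>))"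

lemma prod_real_weight_reverse:
  assumes "\<sigma> \<in> perms n" "D \<subseteq> cycles n \<sigma>" "orb \<sigma> m \<notin> D"
  shows "prod (real_weight e (reverse_cycle \<sigma> m)) D = prod (real_weight e \<sigma>) D"
proof (rule prod.cong[OF refl])
  have p: "permutation \<sigma>" using assms permutation_if_permutes by simp
  fix C assume "C \<in> D"
  then have "C \<in> orb \<sigma> ` {0..<n}" using assms(2) unfolding cycles_def by (rule rev_subsetD)
  then obtain p where "C = orb \<sigma> p" by (elim imageE) simp
  moreover have "p \<notin> orb \<sigma> m"
    using \<open>C \<in> D\<close> assms(3) calculation orb_eq[OF p] by metis
  ultimately show "real_weight e (reverse_cycle \<sigma> m) C = real_weight e \<sigma> C"
    using real_weight_reverse[OF p] by simp
qed

text \<open>For a fully Hermitian matrix the cycle of \<open>i\<close> can be reversed as well; after this last average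
nothing in the sum refers to \<open>i\<close>.\<close>

lemma rdet_hermitian:
  assumes A: "A \<in> carrier_mat n n" and i: "i < n"
    and e: "\<And>p q. p < n \<Longrightarrow> q < n \<Longrightarrow> e p q = A $$ (p, q)"
    and herm: "hermitian_on {0..<n} e"
  shows "rdet i A = of_real (moore_det n e)"
proof -
  have "hermitian_on ({0..<n} - {i}) e" using herm by (simp add: hermitian_on_def)
  then have "rdet i A = (\<Sum>\<sigma>\<in>perms n. of_real (cycles_sign n \<sigma>) *
    (cycle_weight e \<sigma> i * of_real (prod (real_weight e \<sigma>) (cycles n \<sigma> - {orb \<sigma> i}))))"
    by (intro rdet_real_weights[OF A i]) (simp_all add: e)
  also have "\<dots> = (\<Sum>\<sigma>\<in>perms n. of_real (cycles_sign n \<sigma> * prod (real_weight e \<sigma>) (cycles n \<sigma>)))"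
  proof (rule sum_involution[where \<phi> = "\<lambda>\<sigma>. reverse_cycle \<sigma> i"])
    fix \<sigma> assume s: "\<sigma> \<in> perms n"
    have p: "permutation \<sigma>" "permutation (reverse_cycle \<sigma> i)"
      using s reverse_in_perms[OF s] permutation_if_permutes by auto
    show "reverse_cycle \<sigma> i \<in> perms n" by (rule reverse_in_perms[OF s])
    show "reverse_cycle (reverse_cycle \<sigma> i) i = \<sigma>" by (rule perms_reverse_simps[OF s])
    define R where "R = prod (real_weight e \<sigma>) (cycles n \<sigma> - {orb \<sigma> i})"
    define c where "c = (of_real (cycles_sign n \<sigma>) :: quat)"
    define x where "x = cycle_weight e \<sigma> i"
    have R: "prod (real_weight e (reverse_cycle \<sigma> i)) (cycles n \<sigma> - {orb \<sigma> i}) = R"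
      unfolding R_def by (rule prod_real_weight_reverse[OF s]) auto
    have "orb \<sigma> i \<subseteq> {0..<n}" using orb_subset[of \<sigma> "{0..<n}" i] s i by auto
    then have x: "cycle_weight e (reverse_cycle \<sigma> i) i = qcnj x"
      unfolding x_def by (rule cycle_weight_reverse_same[OF p herm])
    have "orb \<sigma> i \<in> cycles n \<sigma>" using i by (simp add: cycles_def)
    then have "prod (real_weight e \<sigma>) (cycles n \<sigma>) = real_weight e \<sigma> (orb \<sigma> i) * R"
      unfolding R_def by (rule prod.remove[OF finite_cycles])
    also have "real_weight e \<sigma> (orb \<sigma> i) = q0 x"
      unfolding x_def by (rule real_weight_orb[OF p(1) self_in_orb[OF p(1)]])
    finally have U: "of_real (cycles_sign n \<sigma> * prod (real_weight e \<sigma>) (cycles n \<sigma>)) =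
      c * (of_real (q0 x) * of_real R)" by (simp add: c_def)
    have "c * (x * of_real R) + c * (qcnj x * of_real R) = c * ((x + qcnj x) * of_real R)"
      by (simp add: algebra_simps)
    also have "\<dots> = c * (of_real (q0 x) * of_real R) + c * (of_real (q0 x) * of_real R)"
      unfolding add_qcnj by (simp add: algebra_simps)
    finally show "of_real (cycles_sign n \<sigma>) *
        (cycle_weight e \<sigma> i * of_real (prod (real_weight e \<sigma>) (cycles n \<sigma> - {orb \<sigma> i}))) +
      of_real (cycles_sign n (reverse_cycle \<sigma> i)) *
        (cycle_weight e (reverse_cycle \<sigma> i) i * of_real (prod (real_weight e (reverse_cycle \<sigma> i))
          (cycles n (reverse_cycle \<sigma> i) - {orb (reverse_cycle \<sigma> i) i}))) =
      of_real (cycles_sign n \<sigma> * prod (real_weight e \<sigma>) (cycles n \<sigma>)) +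
      of_real (cycles_sign n \<sigma> * prod (real_weight e \<sigma>) (cycles n \<sigma>))"
      unfolding perms_reverse_simps[OF s] R x U by (simp only: c_def x_def R_def)
  qed
  finally show ?thesis by (simp add: moore_det_def)
qed

lemma path_cong_start:
  assumes "\<And>q. e x q = e y q"
  shows "path e x zs t = path e y zs t"
  using assms by (cases zs) simp_all

text \<open>Composing with the transposition of \<open>i\<close> and \<open>k\<close> exchanges their successors. If both lie on one
cycle \<open>i us k vs\<close>, the walk from \<open>i\<close> now continues with \<open>vs\<close> and closes up before it meets \<open>k\<close>.\<close>

lemma split_cycle:
  assumes "permutation \<sigma>" "k \<in> orb \<sigma> i" "k \<noteq> i"
  shows "k \<notin> orb (\<sigma> \<circ> transpose i k) i"
proof -
  obtain xs where xs: "cyc \<sigma> i = i # xs" "is_cycle_of \<sigma> (i # xs)" by (rule cyc_Cons[OF assms(1)])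
  have "k \<in> set xs" using assms(2,3) xs(1) by simp
  then obtain us vs where uv: "xs = us @ k # vs" by (metis split_list)
  have d: "distinct (i # us @ k # vs)" and m: "map \<sigma> (i # us @ k # vs) = us @ k # vs @ [i]"
    using xs(2) by (simp_all add: is_cycle_of_def uv)
  have "map \<sigma> (i # us) @ map \<sigma> (k # vs) = (us @ [k]) @ (vs @ [i])" using m by simp
  then have "map \<sigma> (k # vs) = vs @ [i]"
    by (subst (asm) append_eq_append_conv) auto
  moreover have "map (\<sigma> \<circ> transpose i k) vs = map \<sigma> vs"
    using d by (auto simp: transpose_def)
  moreover have "(\<sigma> \<circ> transpose i k) i = \<sigma> k" by simp
  ultimately have "map (\<sigma> \<circ> transpose i k) (i # vs) = vs @ [i]" by (simp only: list.map)
  then have "is_cycle_of (\<sigma> \<circ> transpose i k) (i # vs)"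
    unfolding is_cycle_of_def using d by auto
  then have "cyc (\<sigma> \<circ> transpose i k) i = i # vs" by (rule cyc_eqI)
  then show ?thesis using d by auto
qed

text \<open>Conversely, two cycles \<open>i us\<close> and \<open>k vs\<close> are joined into the single cycle \<open>i vs k us\<close>, and no
other cycle is affected.\<close>

lemma cyc_of_merge:
  assumes "permutation \<sigma>" "k \<notin> orb \<sigma> i" "cyc \<sigma> i = i # us" "cyc \<sigma> k = k # vs"
  shows "cyc (\<sigma> \<circ> transpose i k) i = i # vs @ k # us"
    and "x \<notin> orb \<sigma> i \<Longrightarrow> x \<notin> orb \<sigma> k \<Longrightarrow> cyc (\<sigma> \<circ> transpose i k) x = cyc \<sigma> x"
proof -
  have ci: "is_cycle_of \<sigma> (i # us)" and ck: "is_cycle_of \<sigma> (k # vs)"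
    using is_cycle_of_cyc[OF assms(1)] assms(3,4) by metis+
  have disj: "orb \<sigma> i \<inter> orb \<sigma> k = {}"
    using assms(1,2) orb_eq[OF assms(1)] self_in_orb[OF assms(1)] by blast
  then have d: "distinct (i # vs @ k # us)"
    using ci ck by (auto simp: is_cycle_of_def assms(3,4))
  have "map (\<sigma> \<circ> transpose i k) vs = map \<sigma> vs" "map (\<sigma> \<circ> transpose i k) us = map \<sigma> us"
    using d by (auto simp: transpose_def)
  moreover have "map \<sigma> (i # us) = us @ [i]" "map \<sigma> (k # vs) = vs @ [k]"
    using ci ck by (simp_all add: is_cycle_of_def)
  then have "map \<sigma> (k # vs) @ map \<sigma> (i # us) = vs @ k # us @ [i]" by (simp only: append.assoc append.simps)
  moreover have "(\<sigma> \<circ> transpose i k) i = \<sigma> k" "(\<sigma> \<circ> transpose i k) k = \<sigma> i" by simp_all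
  ultimately have "map (\<sigma> \<circ> transpose i k) (i # vs @ k # us) = vs @ k # us @ [i]"
    by (simp only: list.map map_append append.simps)
  then have "is_cycle_of (\<sigma> \<circ> transpose i k) (i # vs @ k # us)"
    unfolding is_cycle_of_def using d by simp
  then show "cyc (\<sigma> \<circ> transpose i k) i = i # vs @ k # us" by (rule cyc_eqI)
  assume x: "x \<notin> orb \<sigma> i" "x \<notin> orb \<sigma> k"
  obtain xs where xs: "cyc \<sigma> x = x # xs" "is_cycle_of \<sigma> (x # xs)" by (rule cyc_Cons[OF assms(1)])
  have "i \<notin> orb \<sigma> x" "k \<notin> orb \<sigma> x" using x orb_commute[OF assms(1)] by blast+
  then have "map (\<sigma> \<circ> transpose i k) (x # xs) = map \<sigma> (x # xs)"
    unfolding xs(1) by (intro map_cong) (auto simp: transpose_def)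
  then have "is_cycle_of (\<sigma> \<circ> transpose i k) (x # xs)"
    using xs(2) unfolding is_cycle_of_def by metis
  then show "cyc (\<sigma> \<circ> transpose i k) x = cyc \<sigma> x" using xs(1) by (simp add: cyc_eqI)
qed

text \<open>The effect of joining the cycles of \<open>i\<close> and \<open>k\<close> on the sign and on the remaining factors of a term.\<close>

lemma cycles_of_merge:
  assumes s: "\<sigma> \<in> perms n" and i: "i < n" and k: "k < n" and ik: "k \<notin> orb \<sigma> i"
  shows "orb (\<sigma> \<circ> transpose i k) i = orb \<sigma> i \<union> orb \<sigma> k"
    and "cycles n (\<sigma> \<circ> transpose i k) - {orb (\<sigma> \<circ> transpose i k) i} =
      cycles n \<sigma> - {orb \<sigma> i, orb \<sigma> k}"
    and "cycles_sign n (\<sigma> \<circ> transpose i k) = - cycles_sign n \<sigma>"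
    and "prod (real_weight e (\<sigma> \<circ> transpose i k)) (cycles n \<sigma> - {orb \<sigma> i, orb \<sigma> k}) =
      prod (real_weight e \<sigma>) (cycles n \<sigma> - {orb \<sigma> i, orb \<sigma> k})"
proof -
  let ?\<tau> = "\<sigma> \<circ> transpose i k"
  have "?\<tau> permutes {0..<n}"
    using s i k by (intro permutes_compose permutes_swap_id) auto
  then have p: "permutation \<sigma>" "permutation ?\<tau>"
    using s permutation_if_permutes by auto
  obtain us where us: "cyc \<sigma> i = i # us" by (rule cyc_Cons[OF p(1)])
  obtain vs where vs: "cyc \<sigma> k = k # vs" by (rule cyc_Cons[OF p(1)])
  note m = cyc_of_merge[OF p(1) ik us vs]
  show oi: "orb ?\<tau> i = orb \<sigma> i \<union> orb \<sigma> k" unfolding m(1) us vs by auto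
  have off: "x \<notin> orb \<sigma> i \<and> x \<notin> orb \<sigma> k" if "x \<in> orb \<sigma> p" "orb \<sigma> p \<noteq> orb \<sigma> i" "orb \<sigma> p \<noteq> orb \<sigma> k" for x p
    using that orb_eq[OF p(1)] by blast
  show c: "cycles n ?\<tau> - {orb ?\<tau> i} = cycles n \<sigma> - {orb \<sigma> i, orb \<sigma> k}"
  proof (intro equalityI subsetI)
    fix C assume C: "C \<in> cycles n ?\<tau> - {orb ?\<tau> i}"
    then have "C \<in> orb ?\<tau> ` {0..<n}" by (simp only: cycles_def Diff_iff)
    then obtain x where x: "x < n" "C = orb ?\<tau> x" by (elim imageE) simp
    have "orb ?\<tau> x \<noteq> orb ?\<tau> i" using C x(2) by simp
    then have "x \<notin> orb ?\<tau> i" using orb_eq[OF p(2)] by blast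
    then have x': "x \<notin> orb \<sigma> i" "x \<notin> orb \<sigma> k" unfolding oi by auto
    then have "C = orb \<sigma> x" using m(2) x(2) by simp
    moreover have "orb \<sigma> x \<noteq> orb \<sigma> i" "orb \<sigma> x \<noteq> orb \<sigma> k"
      using x' self_in_orb[OF p(1), of x] by auto
    ultimately show "C \<in> cycles n \<sigma> - {orb \<sigma> i, orb \<sigma> k}"
      using x(1) unfolding cycles_def by simp
  next
    fix C assume C: "C \<in> cycles n \<sigma> - {orb \<sigma> i, orb \<sigma> k}"
    then have "C \<in> orb \<sigma> ` {0..<n}" by (simp only: cycles_def Diff_iff)
    then obtain x where x: "x < n" "C = orb \<sigma> x" by (elim imageE) simp
    have "orb \<sigma> x \<noteq> orb \<sigma> i" "orb \<sigma> x \<noteq> orb \<sigma> k" using C x(2) by simp_all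
    then have x': "x \<notin> orb \<sigma> i" "x \<notin> orb \<sigma> k" using orb_eq[OF p(1)] by blast+
    then have "C = orb ?\<tau> x" using m(2) x(2) by simp
    moreover have "x \<notin> orb ?\<tau> i" using x' oi by simp
    then have "orb ?\<tau> x \<noteq> orb ?\<tau> i" using self_in_orb[OF p(2), of x] by auto
    ultimately show "C \<in> cycles n ?\<tau> - {orb ?\<tau> i}"
      using x(1) unfolding cycles_def by simp
  qed
  have in_c: "orb \<sigma> i \<in> cycles n \<sigma>" "orb \<sigma> k \<in> cycles n \<sigma>" "orb ?\<tau> i \<in> cycles n ?\<tau>"
    using i k unfolding cycles_def by simp_all
  have "orb \<sigma> i \<noteq> orb \<sigma> k" using ik self_in_orb[OF p(1), of k] by auto
  then have "card (cycles n \<sigma> - {orb \<sigma> i, orb \<sigma> k}) = card (cycles n \<sigma>) - 2"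
    using in_c by (subst card_Diff_subset) auto
  moreover have "card {orb \<sigma> i, orb \<sigma> k} \<le> card (cycles n \<sigma>)"
    using in_c by (intro card_mono) auto
  moreover have "Suc (card (cycles n ?\<tau> - {orb ?\<tau> i})) = card (cycles n ?\<tau>)"
    by (rule card_Suc_Diff1[OF finite_cycles in_c(3)])
  ultimately have card: "card (cycles n \<sigma>) = Suc (card (cycles n ?\<tau>))"
    using \<open>orb \<sigma> i \<noteq> orb \<sigma> k\<close> unfolding c by simp
  have "card (cycles n \<sigma>) \<le> card {0..<n}" unfolding cycles_def by (rule card_image_le) simp
  then have "n - card (cycles n ?\<tau>) = Suc (n - card (cycles n \<sigma>))" using card by simp
  then show "cycles_sign n ?\<tau> = - cycles_sign n \<sigma>" by (simp add: cycles_sign_def)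
  show "prod (real_weight e ?\<tau>) (cycles n \<sigma> - {orb \<sigma> i, orb \<sigma> k}) =
      prod (real_weight e \<sigma>) (cycles n \<sigma> - {orb \<sigma> i, orb \<sigma> k})"
  proof (rule prod.cong[OF refl])
    fix C assume C: "C \<in> cycles n \<sigma> - {orb \<sigma> i, orb \<sigma> k}"
    then have "C \<in> orb \<sigma> ` {0..<n}" by (simp only: cycles_def Diff_iff)
    then obtain x where x: "C = orb \<sigma> x" by (elim imageE) simp
    have ne: "orb \<sigma> x \<noteq> orb \<sigma> i" "orb \<sigma> x \<noteq> orb \<sigma> k" using C x by simp_all
    have y: "y \<notin> orb \<sigma> i" "y \<notin> orb \<sigma> k" if "y \<in> orb \<sigma> x" for y using off[OF that ne] by auto
    let ?y = "Min (orb \<sigma> x)"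
    have yx: "?y \<in> orb \<sigma> x" by (rule Min_orb_in[OF p(1)])
    have "cyc ?\<tau> ?y = cyc \<sigma> ?y" using m(2) y[OF yx] by simp
    moreover have "?\<tau> z = \<sigma> z" if "z \<in> orb \<sigma> ?y" for z
    proof -
      have "z \<in> orb \<sigma> x" using that orb_eq[OF p(1) yx] by simp
      then have "z \<noteq> i" "z \<noteq> k" using y self_in_orb[OF p(1)] by metis+
      then show ?thesis by (simp add: transpose_def)
    qed
    ultimately show "real_weight e ?\<tau> C = real_weight e \<sigma> C"
      unfolding real_weight_def cycle_weight_def x
      by (intro arg_cong[of _ _ q0] arg_cong[of _ _ prod_list]) (simp cong: map_cong)
  qed
qed

text \<open>Permutations with \<open>k\<close> off the cycle of \<open>i\<close> are matched with those having \<open>k\<close> on it by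
composing with the transposition of \<open>i\<close> and \<open>k\<close>. Let \<open>Q\<close> and \<open>P\<close> be the products along the
cycles of \<open>i\<close> and \<open>k\<close>. The joined cycle has the product \<open>P Q\<close>, because the rows \<open>i\<close> and \<open>k\<close>
agree, and one cycle fewer means the opposite sign. The two terms combine to a multiple of
\<open>(Re P - P) Q\<close>, and these cancel when the cycle of \<open>k\<close> is reversed. The index \<open>i\<close> is left out
of the Hermitian condition so that \<open>e\<close> may be a Hermitian matrix whose row \<open>i\<close> has been
overwritten by row \<open>k\<close>.\<close>

lemma rdet_equal_rows:
  assumes A: "A \<in> carrier_mat n n" and i: "i < n" and k: "k < n" and ik: "i \<noteq> k"
    and e: "\<And>p q. p < n \<Longrightarrow> q < n \<Longrightarrow> e p q = A $$ (p, q)"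
    and rows: "\<And>q. e i q = e k q"
    and herm: "hermitian_on ({0..<n} - {i}) e"
  shows "rdet i A = 0"
proof -
  let ?t = "\<lambda>\<sigma>. \<sigma> \<circ> transpose i k"
  define G where "G = {\<sigma> \<in> perms n. k \<notin> orb \<sigma> i}"
  define R where "R \<sigma> = (of_real (prod (real_weight e \<sigma>) (cycles n \<sigma> - {orb \<sigma> i, orb \<sigma> k})) :: quat)" for \<sigma>
  define c where "c \<sigma> = (of_real (cycles_sign n \<sigma>) :: quat)" for \<sigma>
  define T where "T \<sigma> = of_real (cycles_sign n \<sigma>) *
    (cycle_weight e \<sigma> i * of_real (prod (real_weight e \<sigma>) (cycles n \<sigma> - {orb \<sigma> i})))" for \<sigma>
  have fin: "finite (perms n)" by (rule finite_permutations) simp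
  have tp: "?t \<sigma> \<in> perms n" if "\<sigma> \<in> perms n" for \<sigma>
    using that i k by (auto intro!: permutes_compose permutes_swap_id)
  have tt: "?t (?t \<sigma>) = \<sigma>" for \<sigma> :: "nat \<Rightarrow> nat" by (simp add: comp_assoc)
  have T: "T \<sigma> = c \<sigma> * (cycle_weight e \<sigma> i * (of_real (q0 (cycle_weight e \<sigma> k)) * R \<sigma>))"
    and Tt: "T (?t \<sigma>) = - (c \<sigma> * (cycle_weight e \<sigma> k * cycle_weight e \<sigma> i * R \<sigma>))" if g: "\<sigma> \<in> G" for \<sigma>
  proof -
    have s: "\<sigma> \<in> perms n" and ki: "k \<notin> orb \<sigma> i" using g by (simp_all add: G_def)
    have p: "permutation \<sigma>" "permutation (?t \<sigma>)"
      using s tp[OF s] permutation_if_permutes by auto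
    have "orb \<sigma> k \<in> cycles n \<sigma>" using k by (simp add: cycles_def)
    moreover have "orb \<sigma> k \<noteq> orb \<sigma> i" using ki self_in_orb[OF p(1), of k] by auto
    ultimately have "orb \<sigma> k \<in> cycles n \<sigma> - {orb \<sigma> i}" by simp
    moreover have "cycles n \<sigma> - {orb \<sigma> i} - {orb \<sigma> k} = cycles n \<sigma> - {orb \<sigma> i, orb \<sigma> k}" by blast
    ultimately have "prod (real_weight e \<sigma>) (cycles n \<sigma> - {orb \<sigma> i}) =
      real_weight e \<sigma> (orb \<sigma> k) * prod (real_weight e \<sigma>) (cycles n \<sigma> - {orb \<sigma> i, orb \<sigma> k})"
      using prod.remove[of "cycles n \<sigma> - {orb \<sigma> i}" "orb \<sigma> k" "real_weight e \<sigma>"] by simp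
    also have "real_weight e \<sigma> (orb \<sigma> k) = q0 (cycle_weight e \<sigma> k)"
      by (rule real_weight_orb[OF p(1) self_in_orb[OF p(1)]])
    finally show "T \<sigma> = c \<sigma> * (cycle_weight e \<sigma> i * (of_real (q0 (cycle_weight e \<sigma> k)) * R \<sigma>))"
      by (simp add: T_def c_def R_def)
    obtain us where us: "cyc \<sigma> i = i # us" by (rule cyc_Cons[OF p(1)])
    obtain vs where vs: "cyc \<sigma> k = k # vs" by (rule cyc_Cons[OF p(1)])
    have "cycle_weight e (?t \<sigma>) i = path e i (vs @ k # us) i"
      by (rule cycle_weight_eq_path[OF p(2) cyc_of_merge(1)[OF p(1) ki us vs]])
    also have "\<dots> = path e k vs k * path e i us i"
      unfolding path_append by (simp add: path_cong_start[of e i k, OF rows])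
    also have "\<dots> = cycle_weight e \<sigma> k * cycle_weight e \<sigma> i"
      by (simp only: cycle_weight_eq_path[OF p(1) us] cycle_weight_eq_path[OF p(1) vs])
    finally have "cycle_weight e (?t \<sigma>) i = cycle_weight e \<sigma> k * cycle_weight e \<sigma> i" .
    then show "T (?t \<sigma>) = - (c \<sigma> * (cycle_weight e \<sigma> k * cycle_weight e \<sigma> i * R \<sigma>))"
      unfolding T_def cycles_of_merge(2-4)[OF s i k ki] by (simp add: c_def R_def)
  qed
  have "rdet i A = sum T (perms n)"
    unfolding T_def by (rule rdet_real_weights[OF A i _ herm]) (simp add: e)
  also have "perms n = G \<union> (perms n - G)" by (auto simp: G_def)
  also have "sum T \<dots> = sum T G + sum T (perms n - G)"
    by (rule sum.union_disjoint) (use fin in \<open>auto simp: G_def\<close>)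
  also have "sum T (perms n - G) = (\<Sum>\<sigma>\<in>G. T (?t \<sigma>))"
  proof (rule sum.reindex_bij_witness[of _ ?t ?t])
    fix \<sigma> assume "\<sigma> \<in> perms n - G"
    then have s: "\<sigma> \<in> perms n" "k \<in> orb \<sigma> i" by (simp_all add: G_def)
    have "k \<notin> orb (?t \<sigma>) i"
      by (rule split_cycle) (use s ik permutation_if_permutes in auto)
    then show "?t \<sigma> \<in> G" using tp[OF s(1)] by (simp add: G_def)
  next
    fix \<sigma> assume "\<sigma> \<in> G"
    then have s: "\<sigma> \<in> perms n" "k \<notin> orb \<sigma> i" by (simp_all add: G_def)
    then have "k \<in> orb (?t \<sigma>) i"
      using cycles_of_merge(1)[OF s(1) i k s(2)] self_in_orb permutation_if_permutes[of \<sigma> n] by auto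
    then show "?t \<sigma> \<in> perms n - G" using tp[OF s(1)] by (simp add: G_def)
  qed (simp_all only: tt)
  also have "sum T G + (\<Sum>\<sigma>\<in>G. T (?t \<sigma>)) = (\<Sum>\<sigma>\<in>G. T \<sigma> + T (?t \<sigma>))"
    by (rule sum.distrib[symmetric])
  also have "\<dots> = (\<Sum>\<sigma>\<in>G. c \<sigma> * ((of_real (q0 (cycle_weight e \<sigma> k)) - cycle_weight e \<sigma> k) * cycle_weight e \<sigma> i * R \<sigma>))"
  proof (rule sum.cong[OF refl])
    fix \<sigma> assume g: "\<sigma> \<in> G"
    have "cycle_weight e \<sigma> i * (of_real (q0 (cycle_weight e \<sigma> k)) * R \<sigma>) = of_real (q0 (cycle_weight e \<sigma> k)) * cycle_weight e \<sigma> i * R \<sigma>"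
      by (metis mult.assoc of_real_mult_commute)
    then show "T \<sigma> + T (?t \<sigma>) = c \<sigma> * ((of_real (q0 (cycle_weight e \<sigma> k)) - cycle_weight e \<sigma> k) * cycle_weight e \<sigma> i * R \<sigma>)"
      unfolding T[OF g] Tt[OF g] by (simp add: algebra_simps)
  qed
  also have "\<dots> = (\<Sum>\<sigma>\<in>G. 0)"
  proof (rule sum_involution[where \<phi> = "\<lambda>\<sigma>. reverse_cycle \<sigma> k"])
    fix \<sigma> assume g: "\<sigma> \<in> G"
    have s: "\<sigma> \<in> perms n" and ki: "k \<notin> orb \<sigma> i" using g by (simp_all add: G_def)
    show "reverse_cycle \<sigma> k \<in> G" using ki reverse_in_perms[OF s] by (simp add: G_def perms_reverse_simps[OF s])
    show "reverse_cycle (reverse_cycle \<sigma> k) k = \<sigma>" by (rule perms_reverse_simps[OF s])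
    have p: "permutation \<sigma>" "permutation (reverse_cycle \<sigma> k)"
      using s reverse_in_perms[OF s] permutation_if_permutes by auto
    have ik: "i \<notin> orb \<sigma> k" using ki orb_commute[OF p(1)] by blast
    have "orb \<sigma> k \<subseteq> {0..<n} - {i}" using orb_subset[of \<sigma> "{0..<n}" k] s k ik by auto
    then have xk: "cycle_weight e (reverse_cycle \<sigma> k) k = qcnj (cycle_weight e \<sigma> k)" by (rule cycle_weight_reverse_same[OF p herm])
    have xi: "cycle_weight e (reverse_cycle \<sigma> k) i = cycle_weight e \<sigma> i" by (rule cycle_weight_reverse_other[OF p(1) ik])
    have "prod (real_weight e (reverse_cycle \<sigma> k)) (cycles n \<sigma> - {orb \<sigma> i, orb \<sigma> k}) =
      prod (real_weight e \<sigma>) (cycles n \<sigma> - {orb \<sigma> i, orb \<sigma> k})"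
      by (rule prod_real_weight_reverse[OF s]) auto
    then have R: "R (reverse_cycle \<sigma> k) = R \<sigma>" by (simp add: R_def perms_reverse_simps[OF s])
    have c: "c (reverse_cycle \<sigma> k) = c \<sigma>" by (simp add: c_def perms_reverse_simps[OF s])
    define x where "x = cycle_weight e \<sigma> k"
    define y where "y = cycle_weight e \<sigma> i"
    have "c \<sigma> * ((of_real (q0 x) - x) * y * R \<sigma>) + c \<sigma> * ((of_real (q0 x) - qcnj x) * y * R \<sigma>)
      = c \<sigma> * ((of_real (q0 x) + of_real (q0 x) - (x + qcnj x)) * y * R \<sigma>)"
      by (simp add: algebra_simps)
    also have "\<dots> = 0" by (simp add: add_qcnj)
    finally show "c \<sigma> * ((of_real (q0 (cycle_weight e \<sigma> k)) - cycle_weight e \<sigma> k) * cycle_weight e \<sigma> i * R \<sigma>) +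
      c (reverse_cycle \<sigma> k) * ((of_real (q0 (cycle_weight e (reverse_cycle \<sigma> k) k)) - cycle_weight e (reverse_cycle \<sigma> k) k) *
        cycle_weight e (reverse_cycle \<sigma> k) i * R (reverse_cycle \<sigma> k)) = 0 + 0"
      unfolding xk xi R c x_def y_def by simp
  qed
  finally show ?thesis by simp
qed

section \<open>The Moore determinant under relabelling\<close>

lemma moore_det_equal_rows:
  assumes herm: "hermitian_on {0..<n} e" and i: "i < n" and k: "k < n" and ik: "i \<noteq> k"
    and rows: "\<And>q. e i q = e k q"
  shows "moore_det n e = 0"
proof -
  let ?A = "mat n n (\<lambda>(p, q). e p q)"
  have "of_real (moore_det n e) = rdet i ?A"
    by (rule rdet_hermitian[OF _ i _ herm, symmetric]) simp_all
  also have "\<dots> = 0"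
    by (rule rdet_equal_rows[OF _ i k ik _ rows]) (use herm in \<open>auto simp: hermitian_on_def\<close>)
  finally show ?thesis by simp
qed

text \<open>Here \<open>\<rho>\<close> is the conjugate of \<open>\<sigma>\<close> by \<open>f\<close>. This is said pointwise on the index set, because the
values of \<open>f\<close> elsewhere are arbitrary and \<open>f\<close> need not have an inverse on all of \<open>nat\<close>.\<close>

lemma conjugated_cycles:
  assumes s: "\<sigma> permutes {0..<n}" and f: "bij_betw f {0..<n} {0..<n}"
    and \<rho>: "\<rho> permutes {0..<n}" "\<And>x. x < n \<Longrightarrow> \<rho> (f x) = f (\<sigma> x)"
  shows "cycles_sign n \<rho> = cycles_sign n \<sigma>"
    and "prod (real_weight e \<rho>) (cycles n \<rho>) =
      prod (real_weight (\<lambda>p q. e (f p) (f q)) \<sigma>) (cycles n \<sigma>)"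
proof -
  have p: "permutation \<sigma>" "permutation \<rho>" using s \<rho>(1) permutation_if_permutes by auto
  have inj: "inj_on f {0..<n}" and img: "f ` {0..<n} = {0..<n}" using f by (auto simp: bij_betw_def)
  have sub: "orb \<sigma> x \<subseteq> {0..<n}" if "x < n" for x
    using orb_subset[OF s, of x] that by simp
  have c: "cyc \<rho> (f x) = map f (cyc \<sigma> x)" if "x < n" for x
  proof -
    obtain xs where xs: "cyc \<sigma> x = x # xs" "is_cycle_of \<sigma> (x # xs)" by (rule cyc_Cons[OF p(1)])
    have "map \<rho> (map f (x # xs)) = map f (map \<sigma> (x # xs))"
      using sub[OF that] \<rho>(2) unfolding xs(1) by auto
    also have "\<dots> = map f (rotate1 (x # xs))" using xs(2) by (simp only: is_cycle_of_def)
    also have "\<dots> = rotate1 (map f (x # xs))" by simp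
    finally have "map \<rho> (map f (x # xs)) = rotate1 (map f (x # xs))" .
    moreover have "distinct (map f (x # xs))"
      using xs(2) inj_on_subset[OF inj sub[OF that]] unfolding xs(1) is_cycle_of_def distinct_map by blast
    ultimately have "is_cycle_of \<rho> (map f (x # xs))" by (simp only: is_cycle_of_def) simp
    then show ?thesis unfolding xs(1) list.map by (rule cyc_eqI)
  qed
  have o: "orb \<rho> (f x) = f ` orb \<sigma> x" if "x < n" for x using c[OF that] by simp
  have "cycles n \<rho> = orb \<rho> ` f ` {0..<n}" unfolding cycles_def img by (rule refl)
  also have "\<dots> = (\<lambda>x. f ` orb \<sigma> x) ` {0..<n}" unfolding image_image using o by (intro image_cong) auto
  also have "\<dots> = image f ` cycles n \<sigma>" by (simp add: cycles_def image_image)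
  finally have cs: "cycles n \<rho> = image f ` cycles n \<sigma>" .
  have "cycles n \<sigma> \<subseteq> Pow {0..<n}"
    unfolding cycles_def by (intro image_subsetI PowI sub) simp
  then have ij: "inj_on (image f) (cycles n \<sigma>)"
    using inj by (meson inj_on_image_Pow inj_on_subset)
  then have "card (cycles n \<rho>) = card (cycles n \<sigma>)" unfolding cs by (rule card_image)
  then show "cycles_sign n \<rho> = cycles_sign n \<sigma>" by (simp add: cycles_sign_def)
  have "real_weight e \<rho> (f ` C) = real_weight (\<lambda>p q. e (f p) (f q)) \<sigma> C" if "C \<in> cycles n \<sigma>" for C
  proof -
    have "C \<in> orb \<sigma> ` {0..<n}" using that by (simp only: cycles_def)
    then obtain x where x: "x < n" "C = orb \<sigma> x" by (elim imageE) simp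
    have "map (\<lambda>q. e q (\<rho> q)) (cyc \<rho> (f x)) = map (\<lambda>q. e (f q) (f (\<sigma> q))) (cyc \<sigma> x)"
      using sub[OF x(1)] \<rho>(2) unfolding c[OF x(1)] by auto
    then have "cycle_weight e \<rho> (f x) = cycle_weight (\<lambda>p q. e (f p) (f q)) \<sigma> x" by (simp only: cycle_weight_def)
    moreover have "real_weight e \<rho> (orb \<rho> (f x)) = q0 (cycle_weight e \<rho> (f x))"
      by (rule real_weight_orb[OF p(2) self_in_orb[OF p(2)]])
    moreover have "real_weight (\<lambda>p q. e (f p) (f q)) \<sigma> (orb \<sigma> x) = q0 (cycle_weight (\<lambda>p q. e (f p) (f q)) \<sigma> x)"
      by (rule real_weight_orb[OF p(1) self_in_orb[OF p(1)]])
    ultimately show ?thesis by (simp add: o[OF x(1), symmetric] x(2))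
  qed
  then show "prod (real_weight e \<rho>) (cycles n \<rho>) =
      prod (real_weight (\<lambda>p q. e (f p) (f q)) \<sigma>) (cycles n \<sigma>)"
    unfolding cs prod.reindex[OF ij] by simp
qed

lemma moore_det_relabel:
  assumes f: "bij_betw f {0..<n} {0..<n}"
  shows "moore_det n (\<lambda>p q. e (f p) (f q)) = moore_det n e"
proof -
  \<comment> \<open>extended by the identity, \<open>f\<close> becomes a permutation by which others can be conjugated\<close>
  define h where "h x = (if x < n then f x else x)" for x
  have "bij_betw h {0..<n} {0..<n}" using f by (rule bij_betw_cong[THEN iffD1, rotated]) (simp add: h_def)
  then have h: "h permutes {0..<n}" by (rule bij_imp_permutes) (simp add: h_def)
  let ?k = "inv_into UNIV h"
  have k: "?k permutes {0..<n}" by (rule permutes_inv[OF h])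
  have hk: "h \<circ> ?k = id" "?k \<circ> h = id" using permutes_inv_o[OF h] by auto
  show ?thesis
    unfolding moore_det_def
  proof (rule sum.reindex_bij_witness[of _ "\<lambda>\<rho>. ?k \<circ> \<rho> \<circ> h" "\<lambda>\<sigma>. h \<circ> \<sigma> \<circ> ?k"])
    fix \<sigma> assume s: "\<sigma> \<in> perms n"
    show "?k \<circ> (h \<circ> \<sigma> \<circ> ?k) \<circ> h = \<sigma>"
      using hk(2) by (metis comp_assoc comp_id id_comp)
    have r: "(h \<circ> \<sigma> \<circ> ?k) permutes {0..<n}" using s h k by (auto intro: permutes_compose)
    then show "h \<circ> \<sigma> \<circ> ?k \<in> perms n" by simp
    have "(h \<circ> \<sigma> \<circ> ?k) (f x) = f (\<sigma> x)" if "x < n" for x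
    proof -
      have "?k (f x) = x" using that hk(2) by (metis h_def comp_apply id_apply)
      moreover have "\<sigma> x < n" using s that permutes_in_image[of \<sigma> "{0..<n}" x] by simp
      ultimately show ?thesis by (simp add: h_def)
    qed
    note c = conjugated_cycles(1)[OF _ f r this] conjugated_cycles(2)[OF _ f r this, of e]
    from s have "\<sigma> permutes {0..<n}" by simp
    from c[OF this] show "cycles_sign n (h \<circ> \<sigma> \<circ> ?k) * prod (real_weight e (h \<circ> \<sigma> \<circ> ?k)) (cycles n (h \<circ> \<sigma> \<circ> ?k)) =
      cycles_sign n \<sigma> * prod (real_weight (\<lambda>p q. e (f p) (f q)) \<sigma>) (cycles n \<sigma>)" by (simp only:)
  next
    fix \<rho> assume s: "\<rho> \<in> perms n"
    show "h \<circ> (?k \<circ> \<rho> \<circ> h) \<circ> ?k = \<rho>"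
      using hk(1) by (metis comp_assoc comp_id id_comp)
    show "?k \<circ> \<rho> \<circ> h \<in> perms n" using s h k by (auto intro: permutes_compose)
  qed
qed

abbreviation selfmaps :: "nat \<Rightarrow> (nat \<Rightarrow> nat) set"
  where "selfmaps n \<equiv> {0..<n} \<rightarrow>\<^sub>E {0..<n}"

text \<open>A map that is not injective repeats a row of a Hermitian matrix and contributes \<open>0\<close>; a bijection
only relabels the rows. Summing over all self-maps instead of permutations frees the indices, at
the price of a positive factor that depends on \<open>n\<close> alone.\<close>

lemma sum_moore_det_selfmaps:
  assumes herm: "hermitian_on UNIV e"
  shows "(\<Sum>f\<in>selfmaps n. moore_det n (\<lambda>p q. e (f p) (f q))) =
    real (card {f \<in> selfmaps n. inj_on f {0..<n}}) * moore_det n e"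
proof -
  have "(\<Sum>f\<in>selfmaps n. moore_det n (\<lambda>p q. e (f p) (f q))) =
    (\<Sum>f\<in>selfmaps n. if inj_on f {0..<n} then moore_det n e else 0)"
  proof (rule sum.cong[OF refl])
    fix f assume f: "f \<in> selfmaps n"
    show "moore_det n (\<lambda>p q. e (f p) (f q)) = (if inj_on f {0..<n} then moore_det n e else 0)"
    proof (cases "inj_on f {0..<n}")
      case True
      moreover have "f ` {0..<n} \<subseteq> {0..<n}" using f by auto
      ultimately have "bij_betw f {0..<n} {0..<n}"
        by (simp add: bij_betw_def endo_inj_surj)
      then show ?thesis using True by (simp add: moore_det_relabel)
    next
      case False
      then obtain i k where "i < n" "k < n" "i \<noteq> k" "f i = f k" by (auto simp: inj_on_def)
      then have "moore_det n (\<lambda>p q. e (f p) (f q)) = 0"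
        using herm by (intro moore_det_equal_rows[of n _ i k]) (simp_all add: hermitian_on_def)
      then show ?thesis using False by simp
    qed
  qed
  also have "\<dots> = real (card {f \<in> selfmaps n. inj_on f {0..<n}}) * moore_det n e"
    by (subst sum.inter_filter[symmetric]) (simp_all add: finite_PiE)
  finally show ?thesis .
qed

section \<open>The determinants of \<open>A A\<^sup>*\<close> and \<open>A\<^sup>* A\<close>\<close>

text \<open>Expansion of a map that is additive in every coordinate of \<open>S\<close>. The values \<open>u\<close> off \<open>S\<close> are
arbitrary so that the induction can freeze the coordinates that remain to be expanded.\<close>

lemma sum_PiE_expand:
  fixes F :: "('a \<Rightarrow> 'b :: comm_monoid_add) \<Rightarrow> 'c :: comm_monoid_add"
  assumes "finite S" "finite K"
    and "\<And>v p. p \<in> S \<Longrightarrow> F (v(p := \<Sum>k\<in>K. w p k)) = (\<Sum>k\<in>K. F (v(p := w p k)))"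
  shows "F (\<lambda>p. if p \<in> S then \<Sum>k\<in>K. w p k else u p) =
    (\<Sum>g\<in>S \<rightarrow>\<^sub>E K. F (\<lambda>p. if p \<in> S then w p (g p) else u p))"
  using assms(1,3)
proof (induction S arbitrary: u)
  case empty
  then show ?case by simp
next
  case (insert s S)
  let ?v = "\<lambda>g p. if p \<in> S then w p (g p) else u p"
  have "F (\<lambda>p. if p \<in> insert s S then \<Sum>k\<in>K. w p k else u p) =
    F (\<lambda>p. if p \<in> S then \<Sum>k\<in>K. w p k else (u(s := \<Sum>k\<in>K. w s k)) p)"
    using insert.hyps by (intro arg_cong[of _ _ F]) auto
  also have "\<dots> = (\<Sum>g\<in>S \<rightarrow>\<^sub>E K. F (\<lambda>p. if p \<in> S then w p (g p) else (u(s := \<Sum>k\<in>K. w s k)) p))"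
    by (rule insert.IH) (use insert.prems in simp)
  also have "\<dots> = (\<Sum>g\<in>S \<rightarrow>\<^sub>E K. F ((?v g)(s := \<Sum>k\<in>K. w s k)))"
    using insert.hyps by (intro sum.cong arg_cong[of _ _ F]) auto
  also have "\<dots> = (\<Sum>g\<in>S \<rightarrow>\<^sub>E K. \<Sum>k\<in>K. F ((?v g)(s := w s k)))"
    by (intro sum.cong refl insert.prems) simp
  also have "\<dots> = (\<Sum>k\<in>K. \<Sum>g\<in>S \<rightarrow>\<^sub>E K. F ((?v g)(s := w s k)))"
    by (rule sum.swap)
  also have "\<dots> = (\<Sum>(k, g)\<in>K \<times> (S \<rightarrow>\<^sub>E K). F ((?v g)(s := w s k)))"
    by (rule sum.cartesian_product)
  also have "\<dots> = (\<Sum>(k, g)\<in>K \<times> (S \<rightarrow>\<^sub>E K). F (\<lambda>p. if p \<in> insert s S then w p ((g(s := k)) p) else u p))"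
    using insert.hyps by (intro sum.cong refl) (auto intro!: arg_cong[of _ _ F])
  also have "\<dots> = (\<Sum>g\<in>insert s S \<rightarrow>\<^sub>E K. F (\<lambda>p. if p \<in> insert s S then w p (g p) else u p))"
    unfolding PiE_insert_eq
    by (subst sum.reindex[OF inj_combinator]) (use insert.hyps in \<open>simp_all add: o_def case_prod_unfold\<close>)
  finally show ?case .
qed

lemma q0_sum: "q0 (sum f K) = (\<Sum>k\<in>K. q0 (f k))"
  by (induction K rule: infinite_finite_induct) (simp_all add: q0_add)

text \<open>The product of the real parts of all cycle products with an arbitrary factor \<open>v p\<close> at each
element \<open>p\<close>: the form in which multilinearity can be expressed.\<close>

definition cycle_products :: "nat \<Rightarrow> (nat \<Rightarrow> nat) \<Rightarrow> (nat \<Rightarrow> quat) \<Rightarrow> real"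
  where "cycle_products n \<sigma> v = (\<Prod>C\<in>cycles n \<sigma>. q0 (prod_list (map v (cyc \<sigma> (Min C)))))"

lemma cycle_products_cong:
  assumes s: "\<sigma> \<in> perms n" and "\<And>p. p < n \<Longrightarrow> v p = w p"
  shows "cycle_products n \<sigma> v = cycle_products n \<sigma> w"
  unfolding cycle_products_def
proof (rule prod.cong[OF refl])
  fix C assume "C \<in> cycles n \<sigma>"
  then have "C \<in> orb \<sigma> ` {0..<n}" by (simp only: cycles_def)
  then obtain x where x: "x < n" "C = orb \<sigma> x" by (elim imageE) simp
  have p: "permutation \<sigma>" using s permutation_if_permutes by simp
  have "orb \<sigma> (Min C) = C" using orb_eq[OF p Min_orb_in[OF p]] x(2) by simp
  also have "\<dots> \<subseteq> {0..<n}" using orb_subset[of \<sigma> "{0..<n}" x] s x by simp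
  finally have "map v (cyc \<sigma> (Min C)) = map w (cyc \<sigma> (Min C))"
    using assms(2) by (intro map_cong) auto
  then show "q0 (prod_list (map v (cyc \<sigma> (Min C)))) = q0 (prod_list (map w (cyc \<sigma> (Min C))))"
    by (simp only:)
qed

lemma cycle_products_additive:
  assumes s: "\<sigma> \<in> perms n" and t: "t < n" and "finite K"
  shows "cycle_products n \<sigma> (v(t := \<Sum>k\<in>K. x k)) = (\<Sum>k\<in>K. cycle_products n \<sigma> (v(t := x k)))"
proof -
  have p: "permutation \<sigma>" using s permutation_if_permutes by simp
  let ?D = "cycles n \<sigma> - {orb \<sigma> t}"
  define R where "R = (\<Prod>C\<in>?D. q0 (prod_list (map v (cyc \<sigma> (Min C)))))"
  have oM: "orb \<sigma> (Min (orb \<sigma> y)) = orb \<sigma> y" for y by (rule orb_eq[OF p Min_orb_in[OF p]])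
  have "t \<in> orb \<sigma> (Min (orb \<sigma> t))" using oM self_in_orb[OF p, of t] by simp
  then obtain us vs where uv: "cyc \<sigma> (Min (orb \<sigma> t)) = us @ t # vs" by (metis split_list)
  have "distinct (us @ t # vs)"
    using is_cycle_of_cyc[OF p, of "Min (orb \<sigma> t)"] unfolding uv is_cycle_of_def by simp
  then have tn: "t \<notin> set us" "t \<notin> set vs" by auto
  have main: "cycle_products n \<sigma> (v(t := z)) = q0 (prod_list (map v us) * z * prod_list (map v vs)) * R" for z
  proof -
    have "orb \<sigma> t \<in> cycles n \<sigma>" using t by (simp add: cycles_def)
    then have "cycle_products n \<sigma> (v(t := z)) = q0 (prod_list (map (v(t := z)) (cyc \<sigma> (Min (orb \<sigma> t))))) *
      (\<Prod>C\<in>?D. q0 (prod_list (map (v(t := z)) (cyc \<sigma> (Min C)))))"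
      unfolding cycle_products_def by (rule prod.remove[OF finite_cycles])
    also have "(\<Prod>C\<in>?D. q0 (prod_list (map (v(t := z)) (cyc \<sigma> (Min C))))) = R"
      unfolding R_def
    proof (rule prod.cong[OF refl])
      fix C assume C: "C \<in> ?D"
      then have "C \<in> orb \<sigma> ` {0..<n}" by (simp only: cycles_def Diff_iff)
      then obtain y where y: "C = orb \<sigma> y" by (elim imageE) simp
      have "t \<notin> orb \<sigma> (Min C)" using C orb_eq[OF p, of t y] oM[of y] unfolding y by auto
      then have "map (v(t := z)) (cyc \<sigma> (Min C)) = map v (cyc \<sigma> (Min C))" by (intro map_cong) auto
      then show "q0 (prod_list (map (v(t := z)) (cyc \<sigma> (Min C)))) = q0 (prod_list (map v (cyc \<sigma> (Min C))))"
        by (simp only:)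
    qed
    also have "map (v(t := z)) (cyc \<sigma> (Min (orb \<sigma> t))) = map v us @ z # map v vs"
      using tn unfolding uv by simp
    finally show ?thesis by (simp only: prod_list.append prod_list.Cons mult.assoc)
  qed
  have "q0 (a * (\<Sum>k\<in>K. x k) * b) = (\<Sum>k\<in>K. q0 (a * x k * b))" for a b
    by (simp add: sum_distrib_left sum_distrib_right q0_sum)
  then show ?thesis unfolding main by (simp add: sum_distrib_right)
qed

lemma cycle_products_expand:
  assumes s: "\<sigma> \<in> perms n"
  shows "cycle_products n \<sigma> (\<lambda>p. \<Sum>k\<in>{0..<n}. w p k) =
    (\<Sum>g\<in>selfmaps n. cycle_products n \<sigma> (\<lambda>p. w p (g p)))"
proof -
  have "cycle_products n \<sigma> (\<lambda>p. \<Sum>k\<in>{0..<n}. w p k) =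
    cycle_products n \<sigma> (\<lambda>p. if p \<in> {0..<n} then \<Sum>k\<in>{0..<n}. w p k else 0)"
    by (rule cycle_products_cong[OF s]) simp
  also have "\<dots> = (\<Sum>g\<in>selfmaps n. cycle_products n \<sigma> (\<lambda>p. if p \<in> {0..<n} then w p (g p) else 0))"
    by (intro sum_PiE_expand cycle_products_additive[OF s]) simp_all
  also have "\<dots> = (\<Sum>g\<in>selfmaps n. cycle_products n \<sigma> (\<lambda>p. w p (g p)))"
    by (intro sum.cong refl cycle_products_cong[OF s]) simp
  finally show ?thesis .
qed

text \<open>Both products are the same cyclic word in \<open>x\<close> and \<open>y\<close>, cut before a letter \<open>x\<close> or before a
letter \<open>y\<close>. The common middle part \<open>c\<close> is exhibited, rather than an equation multiplied by \<open>x p\<close>,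
as \<open>x p\<close> may vanish.\<close>

lemma prod_list_shift:
  assumes "map \<sigma> (p # ps) = ps @ [z]"
  shows "\<exists>c. prod_list (map (\<lambda>q. x q * y q) (p # ps)) = x p * c \<and>
    prod_list (map (\<lambda>q. y q * x (\<sigma> q)) (p # ps)) = c * (x z :: 'b :: monoid_mult)"
  using assms
proof (induction ps arbitrary: p)
  case Nil
  then show ?case by auto
next
  case (Cons q ps)
  then obtain c where "prod_list (map (\<lambda>q. x q * y q) (q # ps)) = x q * c"
    "prod_list (map (\<lambda>q. y q * x (\<sigma> q)) (q # ps)) = c * x z" by auto
  then show ?case using Cons.prems by (intro exI[of _ "y p * x q * c"]) (simp add: mult.assoc)
qed

lemma cycle_products_shift:
  assumes s: "\<sigma> \<in> perms n"
  shows "cycle_products n \<sigma> (\<lambda>q. x q * y q) = cycle_products n \<sigma> (\<lambda>q. y q * x (\<sigma> q))"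
  unfolding cycle_products_def
proof (rule prod.cong[OF refl])
  fix C
  have p: "permutation \<sigma>" using s permutation_if_permutes by simp
  obtain xs where xs: "cyc \<sigma> (Min C) = Min C # xs" "is_cycle_of \<sigma> (Min C # xs)" by (rule cyc_Cons[OF p])
  then have "map \<sigma> (Min C # xs) = xs @ [Min C]" by (simp add: is_cycle_of_def)
  from prod_list_shift[OF this, of x y]
  show "q0 (prod_list (map (\<lambda>q. x q * y q) (cyc \<sigma> (Min C)))) =
    q0 (prod_list (map (\<lambda>q. y q * x (\<sigma> q)) (cyc \<sigma> (Min C))))"
    unfolding xs(1) by (metis q0_mult_commute)
qed

text \<open>The entries of \<open>A A\<^sup>*\<close>, where \<open>a\<close> gives the entries of \<open>A\<close>.\<close>

definition gram :: "nat \<Rightarrow> (nat \<Rightarrow> nat \<Rightarrow> quat) \<Rightarrow> nat \<Rightarrow> nat \<Rightarrow> quat"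
  where "gram n a p q = (\<Sum>k\<in>{0..<n}. a p k * qcnj (a q k))"

lemma qcnj_zero [simp]: "qcnj 0 = 0"
  by (simp add: qcnj_def zero_quat_def)

lemma qcnj_add: "qcnj (p + q) = qcnj p + qcnj q"
  by (simp add: qcnj_def plus_quat_def)

lemma qcnj_sum: "qcnj (sum f K) = (\<Sum>k\<in>K. qcnj (f k))"
  by (induction K rule: infinite_finite_induct) (simp_all add: qcnj_add)

lemma hermitian_gram: "hermitian_on X (gram n a)"
  by (simp add: hermitian_on_def gram_def qcnj_sum qcnj_mult)

lemma sum_moore_det_gram:
  "(\<Sum>f\<in>selfmaps n. moore_det n (\<lambda>p q. gram n a (f p) (f q))) =
    (\<Sum>\<sigma>\<in>perms n. cycles_sign n \<sigma> * (\<Sum>(f, g)\<in>selfmaps n \<times> selfmaps n.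
      cycle_products n \<sigma> (\<lambda>p. a (f p) (g p) * qcnj (a (f (\<sigma> p)) (g p)))))"
proof -
  have "prod (real_weight (\<lambda>p q. gram n a (f p) (f q)) \<sigma>) (cycles n \<sigma>) =
    (\<Sum>g\<in>selfmaps n. cycle_products n \<sigma> (\<lambda>p. a (f p) (g p) * qcnj (a (f (\<sigma> p)) (g p))))"
    if "\<sigma> \<in> perms n" for f \<sigma>
    using cycle_products_expand[OF that, of "\<lambda>p k. a (f p) k * qcnj (a (f (\<sigma> p)) k)"]
    by (simp only: cycle_products_def real_weight_def[abs_def] cycle_weight_def gram_def)
  then have "(\<Sum>f\<in>selfmaps n. moore_det n (\<lambda>p q. gram n a (f p) (f q))) =
    (\<Sum>f\<in>selfmaps n. \<Sum>\<sigma>\<in>perms n. cycles_sign n \<sigma> *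
      (\<Sum>g\<in>selfmaps n. cycle_products n \<sigma> (\<lambda>p. a (f p) (g p) * qcnj (a (f (\<sigma> p)) (g p)))))"
    unfolding moore_det_def by (intro sum.cong refl) simp
  then show ?thesis
    by (subst (asm) sum.swap) (simp add: sum_distrib_left[symmetric] sum.cartesian_product)
qed

text \<open>This is \<open>det (A A\<^sup>*) = det (A\<^sup>* A)\<close>. After summation over all self-maps \<open>f\<close> and expansion of the
entries, a cycle of \<open>\<sigma>\<close> contributes the real part of a cyclic word with alternating letters
\<open>a (f p) (g p)\<close> and \<open>qcnj (a (f (\<sigma> p)) (g p))\<close>. Read from the second letter onwards, it is the word
that belongs to the adjoint of \<open>a\<close> and to the maps \<open>g\<close> and \<open>f \<circ> \<sigma>\<close>. Since \<open>(f, g) \<mapsto> (g, f \<circ> \<sigma>)\<close> is a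
bijection, the two sums agree for every \<open>\<sigma>\<close>.\<close>

lemma moore_det_gram_adjoint:
  "moore_det n (gram n a) = moore_det n (gram n (\<lambda>p q. qcnj (a q p)))"
proof -
  let ?b = "\<lambda>p q. qcnj (a q p)" and ?N = "real (card {f \<in> selfmaps n. inj_on f {0..<n}})"
  have inner: "(\<Sum>(f, g)\<in>selfmaps n \<times> selfmaps n.
      cycle_products n \<sigma> (\<lambda>p. a (f p) (g p) * qcnj (a (f (\<sigma> p)) (g p)))) =
    (\<Sum>(f, g)\<in>selfmaps n \<times> selfmaps n.
      cycle_products n \<sigma> (\<lambda>p. ?b (f p) (g p) * qcnj (?b (f (\<sigma> p)) (g p))))"
    if s: "\<sigma> \<in> perms n" for \<sigma>
  proof (rule sum.reindex_bij_witness[of _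
      "\<lambda>(f, g). (restrict (g \<circ> inv_into UNIV \<sigma>) {0..<n}, f)" "\<lambda>(f, g). (g, restrict (f \<circ> \<sigma>) {0..<n})"])
    have sp: "\<sigma> permutes {0..<n}" using s by simp
    have lt: "\<sigma> p < n \<longleftrightarrow> p < n" "inv_into UNIV \<sigma> p < n \<longleftrightarrow> p < n" for p
      using permutes_in_image[OF sp, of p] permutes_in_image[OF permutes_inv[OF sp], of p] by simp_all
    have iv: "\<sigma> (inv_into UNIV \<sigma> p) = p" "inv_into UNIV \<sigma> (\<sigma> p) = p" for p
      using permutes_inverses[OF sp] by auto
    fix fg assume "fg \<in> selfmaps n \<times> selfmaps n"
    then obtain f g where fg: "fg = (f, g)" "f \<in> selfmaps n" "g \<in> selfmaps n" by auto
    have "restrict (restrict (f \<circ> \<sigma>) {0..<n} \<circ> inv_into UNIV \<sigma>) {0..<n} = f"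
      "restrict (restrict (g \<circ> inv_into UNIV \<sigma>) {0..<n} \<circ> \<sigma>) {0..<n} = g"
      using fg(2,3) by (auto simp: restrict_def fun_eq_iff iv lt PiE_def extensional_def)
    then show "(case case fg of (f, g) \<Rightarrow> (g, restrict (f \<circ> \<sigma>) {0..<n}) of
        (f, g) \<Rightarrow> (restrict (g \<circ> inv_into UNIV \<sigma>) {0..<n}, f)) = fg"
      "(case case fg of (f, g) \<Rightarrow> (restrict (g \<circ> inv_into UNIV \<sigma>) {0..<n}, f) of
        (f, g) \<Rightarrow> (g, restrict (f \<circ> \<sigma>) {0..<n})) = fg"
      by (simp_all only: fg(1) prod.case)
    show "(case fg of (f, g) \<Rightarrow> (g, restrict (f \<circ> \<sigma>) {0..<n})) \<in> selfmaps n \<times> selfmaps n"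
      "(case fg of (f, g) \<Rightarrow> (restrict (g \<circ> inv_into UNIV \<sigma>) {0..<n}, f)) \<in> selfmaps n \<times> selfmaps n"
      using fg lt by (auto simp: PiE_iff)
    have "cycle_products n \<sigma> (\<lambda>p. a (f p) (g p) * qcnj (a (f (\<sigma> p)) (g p))) =
      cycle_products n \<sigma> (\<lambda>p. qcnj (a (f (\<sigma> p)) (g p)) * a (f (\<sigma> p)) (g (\<sigma> p)))"
      by (rule cycle_products_shift[OF s])
    also have "\<dots> = cycle_products n \<sigma> (\<lambda>p. ?b (g p) (restrict (f \<circ> \<sigma>) {0..<n} p) *
        qcnj (?b (g (\<sigma> p)) (restrict (f \<circ> \<sigma>) {0..<n} p)))"
      by (rule cycle_products_cong[OF s]) simp
    finally show "(case case fg of (f, g) \<Rightarrow> (g, restrict (f \<circ> \<sigma>) {0..<n}) of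
        (f, g) \<Rightarrow> cycle_products n \<sigma> (\<lambda>p. ?b (f p) (g p) * qcnj (?b (f (\<sigma> p)) (g p)))) =
      (case fg of (f, g) \<Rightarrow> cycle_products n \<sigma> (\<lambda>p. a (f p) (g p) * qcnj (a (f (\<sigma> p)) (g p))))"
      by (simp add: fg(1))
  qed
  have "?N * moore_det n (gram n a) = ?N * moore_det n (gram n ?b)"
    unfolding sum_moore_det_selfmaps[OF hermitian_gram, symmetric] sum_moore_det_gram
    by (rule sum.cong[OF refl]) (simp only: inner)
  \<comment> \<open>the identity shows that the factor to be cancelled is positive\<close>
  moreover have "restrict id {0..<n} \<in> {f \<in> selfmaps n. inj_on f {0..<n}}" by (auto simp: inj_on_def)
  then have "card {f \<in> selfmaps n. inj_on f {0..<n}} > 0"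
    by (intro card_gt_0_iff[THEN iffD2] conjI) (blast, simp add: finite_PiE)
  ultimately show ?thesis by simp
qed

section \<open>Cramer's rule\<close>

text \<open>Each term of \<open>rdet\<^sub>i\<close> starts with exactly one entry of row \<open>i\<close> and no other factor comes from that
row; so \<open>rdet\<^sub>i\<close> is left linear in row \<open>i\<close>, with coefficients \<open>R\<close> that do not depend on \<open>v\<close>.\<close>

lemma rdet_row_expansion:
  assumes H: "H \<in> carrier_mat n n" and i: "i < n"
  shows "\<exists>R. \<forall>v \<in> carrier_mat 1 n.
    rdet i (replace_row H i v) = (\<Sum>j\<in>{0..<n}. v $$ (0, j) * R j)"
proof -
  define h where "h p q = H $$ (p, q)" for p q
  define K where "K \<sigma> = of_real (cycles_sign n \<sigma>) *
    (prod_list (map (\<lambda>q. h q (\<sigma> q)) (tl (cyc \<sigma> i))) *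
      prod_list (map (cycle_weight h \<sigma>) (sorted_list_of_set (heads n i \<sigma>))))" for \<sigma>
  define R where "R j = (\<Sum>\<sigma> | \<sigma> \<in> perms n \<and> \<sigma> i = j. K \<sigma>)" for j
  have "rdet i (replace_row H i v) = (\<Sum>j\<in>{0..<n}. v $$ (0, j) * R j)" for v
  proof -
    define e where "e p q = (if p = i then v $$ (0, q) else h p q)" for p q
    have "rdet i (replace_row H i v) = (\<Sum>\<sigma>\<in>perms n. of_real (cycles_sign n \<sigma>) *
      (cycle_weight e \<sigma> i * prod_list (map (cycle_weight e \<sigma>) (sorted_list_of_set (heads n i \<sigma>)))))"
      by (rule rdet_eq[OF _ i]) (use H in \<open>auto simp: replace_row_def e_def h_def\<close>)
    also have "\<dots> = (\<Sum>\<sigma>\<in>perms n. v $$ (0, \<sigma> i) * K \<sigma>)"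
    proof (rule sum.cong[OF refl])
      fix \<sigma> assume "\<sigma> \<in> perms n"
      then have p: "permutation \<sigma>" using permutation_if_permutes by simp
      obtain us where us: "cyc \<sigma> i = i # us" "is_cycle_of \<sigma> (i # us)" by (rule cyc_Cons[OF p])
      then have "i \<notin> set us" by (simp add: is_cycle_of_def)
      then have "map (\<lambda>q. e q (\<sigma> q)) us = map (\<lambda>q. h q (\<sigma> q)) us"
        by (intro map_cong) (auto simp: e_def)
      then have "cycle_weight e \<sigma> i = v $$ (0, \<sigma> i) * prod_list (map (\<lambda>q. h q (\<sigma> q)) (tl (cyc \<sigma> i)))"
        unfolding cycle_weight_def us(1) by (simp only: list.map list.sel prod_list.Cons) (simp add: e_def)
      moreover have "cycle_weight e \<sigma> k = cycle_weight h \<sigma> k" if "k \<in> heads n i \<sigma>" for k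
      proof -
        have "i \<notin> orb \<sigma> k" using that by (simp add: heads_def)
        then have "map (\<lambda>q. e q (\<sigma> q)) (cyc \<sigma> k) = map (\<lambda>q. h q (\<sigma> q)) (cyc \<sigma> k)"
          by (intro map_cong) (auto simp: e_def)
        then show ?thesis by (simp only: cycle_weight_def)
      qed
      then have "map (cycle_weight e \<sigma>) (sorted_list_of_set (heads n i \<sigma>)) =
        map (cycle_weight h \<sigma>) (sorted_list_of_set (heads n i \<sigma>))" by (intro map_cong) simp_all
      moreover have "of_real c * (x * y * z) = x * (of_real c * (y * z))" for c and x y z :: quat
        by (metis mult.assoc of_real_mult_commute)
      ultimately show "of_real (cycles_sign n \<sigma>) *
          (cycle_weight e \<sigma> i * prod_list (map (cycle_weight e \<sigma>) (sorted_list_of_set (heads n i \<sigma>)))) =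
        v $$ (0, \<sigma> i) * K \<sigma>" by (simp only: K_def)
    qed
    also have "\<dots> = (\<Sum>j\<in>{0..<n}. \<Sum>\<sigma> | \<sigma> \<in> perms n \<and> \<sigma> i = j. v $$ (0, \<sigma> i) * K \<sigma>)"
    proof (rule sum.group[symmetric])
      show "finite (perms n)" by (rule finite_permutations) simp
      show "(\<lambda>\<sigma>. \<sigma> i) ` perms n \<subseteq> {0..<n}"
        using i permutes_in_image[of _ "{0..<n}" i] by auto
    qed simp
    also have "\<dots> = (\<Sum>j\<in>{0..<n}. v $$ (0, j) * R j)"
      by (simp add: R_def sum_distrib_left)
    finally show ?thesis .
  qed
  then show ?thesis by blast
qed

lemma conj_transpose_carrier [simp]: "A \<in> carrier_mat n m \<Longrightarrow> conj_transpose A \<in> carrier_mat m n"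
  by (simp add: conj_transpose_def)

lemma index_conj_transpose [simp]:
  "A \<in> carrier_mat n m \<Longrightarrow> i < m \<Longrightarrow> j < n \<Longrightarrow> conj_transpose A $$ (i, j) = qcnj (A $$ (j, i))"
  by (auto simp: conj_transpose_def)

lemma index_mult_sum:
  "A \<in> carrier_mat n m \<Longrightarrow> B \<in> carrier_mat m k \<Longrightarrow> i < n \<Longrightarrow> j < k \<Longrightarrow>
    (A * B) $$ (i, j) = (\<Sum>l\<in>{0..<m}. A $$ (i, l) * B $$ (l, j))"
  by (auto simp: scalar_prod_def)

lemma conj_transpose_mult:
  assumes "A \<in> carrier_mat n m" "B \<in> carrier_mat m k"
  shows "conj_transpose (A * B) = conj_transpose B * conj_transpose A"
proof (rule eq_matI)
  have AB: "A * B \<in> carrier_mat n k" using assms by simp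
  have BA: "conj_transpose B * conj_transpose A \<in> carrier_mat k n"
    by (intro mult_carrier_mat[of _ _ m] conj_transpose_carrier assms)
  fix i j assume "i < dim_row (conj_transpose B * conj_transpose A)"
    "j < dim_col (conj_transpose B * conj_transpose A)"
  then have ij: "i < k" "j < n" using BA by auto
  have "conj_transpose (A * B) $$ (i, j) = qcnj (\<Sum>l\<in>{0..<m}. A $$ (j, l) * B $$ (l, i))"
    using ij index_conj_transpose[OF AB] index_mult_sum[OF assms] by simp
  also have "\<dots> = (\<Sum>l\<in>{0..<m}. conj_transpose B $$ (i, l) * conj_transpose A $$ (l, j))"
    using ij assms by (simp add: qcnj_sum qcnj_mult)
  also have "\<dots> = (conj_transpose B * conj_transpose A) $$ (i, j)"
    using ij assms by (intro index_mult_sum[symmetric]) auto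
  finally show "conj_transpose (A * B) $$ (i, j) = (conj_transpose B * conj_transpose A) $$ (i, j)" .
qed (use assms in \<open>auto simp: conj_transpose_def\<close>)

lemma conj_transpose_one: "conj_transpose (1\<^sub>m n) = 1\<^sub>m n"
  by (rule eq_matI) (auto simp: conj_transpose_def qcnj_def one_quat_def zero_quat_def)

text \<open>Let \<open>K\<close> have the cofactors of row \<open>i\<close>, divided by the determinant, as its column \<open>i\<close>. Overwriting
row \<open>i\<close> of \<open>H\<close> by row \<open>k\<close> yields the determinant if \<open>k = i\<close> and \<open>0\<close> otherwise, so \<open>K\<close> is a right
inverse. That it is also a left inverse follows from \<open>H = H\<^sup>*\<close>: the adjoint of \<open>K\<close> is
a left inverse, and the two one-sided inverses coincide.\<close>

lemma hermitian_cramer_inverse: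
  assumes H: "H \<in> carrier_mat n n" and e: "\<And>p q. p < n \<Longrightarrow> q < n \<Longrightarrow> e p q = H $$ (p, q)"
    and herm: "hermitian_on {0..<n} e" and d: "moore_det n e \<noteq> 0"
  obtains K where "K \<in> carrier_mat n n" "H * K = 1\<^sub>m n" "K * H = 1\<^sub>m n"
    "\<And>v i. v \<in> carrier_mat 1 n \<Longrightarrow> i < n \<Longrightarrow>
      rdet i (replace_row H i v) / of_real (moore_det n e) = (v * K) $$ (0, i)"
proof -
  let ?d = "of_real (moore_det n e) :: quat"
  have "\<forall>i. \<exists>R. i < n \<longrightarrow> (\<forall>v \<in> carrier_mat 1 n.
    rdet i (replace_row H i v) = (\<Sum>j\<in>{0..<n}. v $$ (0, j) * R j))"
    using rdet_row_expansion[OF H] by blast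
  then obtain R where R: "\<And>i v. i < n \<Longrightarrow> v \<in> carrier_mat 1 n \<Longrightarrow>
    rdet i (replace_row H i v) = (\<Sum>j\<in>{0..<n}. v $$ (0, j) * R i j)" by metis
  define K where "K = mat n n (\<lambda>(j, i). R i j / ?d)"
  have K: "K \<in> carrier_mat n n" by (simp add: K_def)
  have vK: "rdet i (replace_row H i v) / ?d = (v * K) $$ (0, i)"
    if v: "v \<in> carrier_mat 1 n" and i: "i < n" for v i
  proof -
    have "(v * K) $$ (0, i) = (\<Sum>j\<in>{0..<n}. v $$ (0, j) * (R i j / ?d))"
      using index_mult_sum[OF v K _ i] i by (simp add: K_def)
    then show ?thesis unfolding R[OF i v] by (simp add: sum_distrib_right divide_inverse mult.assoc)
  qed
  have HK: "H * K = 1\<^sub>m n"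
  proof (rule eq_matI)
    fix k i assume "k < dim_row (1\<^sub>m n :: quat mat)" "i < dim_col (1\<^sub>m n :: quat mat)"
    then have ki: "k < n" "i < n" by simp_all
    define r where "r = mat 1 n (\<lambda>(_, q). H $$ (k, q))"
    have r: "r \<in> carrier_mat 1 n" by (simp add: r_def)
    have "(H * K) $$ (k, i) = (r * K) $$ (0, i)"
      using index_mult_sum[OF H K ki] index_mult_sum[OF r K _ ki(2)] by (simp add: r_def)
    also have "\<dots> = rdet i (replace_row H i r) / ?d" by (rule vK[OF r ki(2), symmetric])
    also have "\<dots> = (if k = i then 1 else 0)"
    proof (cases "k = i")
      case True
      have "replace_row H i r = H"
        by (rule eq_matI) (use H ki True in \<open>auto simp: replace_row_def r_def\<close>)
      then show ?thesis using rdet_hermitian[OF H ki(2) e herm] d True by simp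
    next
      case False
      define e' where "e' p q = (if p = i then e k q else e p q)" for p q
      have "rdet i (replace_row H i r) = 0"
      proof (rule rdet_equal_rows[OF _ ki(2) ki(1)])
        show "replace_row H i r \<in> carrier_mat n n" using H by (simp add: replace_row_def)
        show "e' p q = replace_row H i r $$ (p, q)" if "p < n" "q < n" for p q
          using that H ki e by (auto simp: e'_def replace_row_def r_def)
        show "hermitian_on ({0..<n} - {i}) e'"
          using herm by (auto simp: hermitian_on_def e'_def)
      qed (use False in \<open>auto simp: e'_def\<close>)
      then show ?thesis using False by simp
    qed
    finally show "(H * K) $$ (k, i) = 1\<^sub>m n $$ (k, i)" using ki by simp
  qed (use H K in auto)
  have "conj_transpose H = H"
    by (rule eq_matI) (use H e herm in \<open>auto simp: conj_transpose_def hermitian_on_def\<close>)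
  then have K'H: "conj_transpose K * H = 1\<^sub>m n"
    using conj_transpose_mult[OF H K] by (simp add: HK conj_transpose_one)
  have "K = (conj_transpose K * H) * K" using K K'H by simp
  also have "\<dots> = conj_transpose K * (H * K)"
    by (rule assoc_mult_mat[OF conj_transpose_carrier[OF K] H K])
  also have "\<dots> = conj_transpose K"
    unfolding HK by (rule right_mult_one_mat[OF conj_transpose_carrier[OF K]])
  finally have "K * H = 1\<^sub>m n" using K'H by simp
  with that K HK vK show thesis by blast
qed

lemma herm_det_eq_moore_det:
  assumes H: "H \<in> carrier_mat n n" and "0 < n"
    and e: "\<And>p q. p < n \<Longrightarrow> q < n \<Longrightarrow> e p q = H $$ (p, q)"
    and herm: "hermitian_on {0..<n} e"
  shows "herm_det H = moore_det n e"
  unfolding herm_det_def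
proof (rule the_equality)
  have "dim_row H = n" using H by simp
  then show "\<forall>i<dim_row H. rdet i H = of_real (moore_det n e)"
    using rdet_hermitian[OF H _ e herm] by simp
  fix d assume "\<forall>i<dim_row H. rdet i H = of_real d"
  then have "rdet 0 H = of_real d" using \<open>0 < n\<close> H by auto
  then show "d = moore_det n e"
    using rdet_hermitian[OF H \<open>0 < n\<close> e herm] by (metis of_real_eq_iff)
qed

theorem theorem9p2:
  fixes n :: nat and A x y :: "quat mat"
  assumes "A \<in> carrier_mat n n" and "x \<in> carrier_mat 1 n" and "y \<in> carrier_mat 1 n"
    and "ddet A \<noteq> 0"
  shows "x * A = y \<longleftrightarrow>
    (\<forall>i<n. x $$ (0, i) =
      rdet i (replace_row (A * conj_transpose A) i (y * conj_transpose A)) / of_real (ddet A))"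
proof (cases "n = 0")
  \<comment> \<open>a matrix without rows has no row determinant, so its \<open>herm_det\<close> is unspecified\<close>
  case True
  then have "x * A = y" using assms(1-3) by (intro eq_matI) auto
  with True show ?thesis by simp
next
  case False
  note A = assms(1) and x = assms(2) and y = assms(3)
  define a where "a p q = A $$ (p, q)" for p q
  let ?B = "conj_transpose A" and ?b = "\<lambda>p q. qcnj (a q p)"
  have B: "?B \<in> carrier_mat n n" using A by simp
  have AB: "A * ?B \<in> carrier_mat n n" and BA: "?B * A \<in> carrier_mat n n"
    using A B by (blast intro: mult_carrier_mat)+
  have eAB: "gram n a p q = (A * ?B) $$ (p, q)" if "p < n" "q < n" for p q
    using index_mult_sum[OF A B that] that A by (simp add: gram_def a_def)
  have eBA: "gram n ?b p q = (?B * A) $$ (p, q)" if "p < n" "q < n" for p q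
    using index_mult_sum[OF B A that] that A by (simp add: gram_def a_def)
  have d: "ddet A = moore_det n (gram n ?b)"
    unfolding ddet_def by (rule herm_det_eq_moore_det[OF BA]) (use False in \<open>simp_all add: eBA hermitian_gram\<close>)
  then have d': "ddet A = moore_det n (gram n a)" by (simp only: moore_det_gram_adjoint[of n a])
  have nz: "moore_det n (gram n a) \<noteq> 0" "moore_det n (gram n ?b) \<noteq> 0"
    using assms(4) d d' by simp_all
  obtain K where K: "K \<in> carrier_mat n n" "A * ?B * K = 1\<^sub>m n" "K * (A * ?B) = 1\<^sub>m n"
    and rK: "\<And>v i. v \<in> carrier_mat 1 n \<Longrightarrow> i < n \<Longrightarrow>
      rdet i (replace_row (A * ?B) i v) / of_real (moore_det n (gram n a)) = (v * K) $$ (0, i)"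
    by (rule hermitian_cramer_inverse[OF AB _ hermitian_gram nz(1)])
      (erule (1) eAB, rule that, assumption+)
  obtain L where L: "L \<in> carrier_mat n n" "?B * A * L = 1\<^sub>m n"
    by (rule hermitian_cramer_inverse[OF BA _ hermitian_gram nz(2)])
      (erule (1) eBA, rule that, assumption+)
  have yB: "y * ?B \<in> carrier_mat 1 n" using y B by simp
  have "(\<forall>i<n. x $$ (0, i) = rdet i (replace_row (A * ?B) i (y * ?B)) / of_real (ddet A)) \<longleftrightarrow>
    (\<forall>i<n. x $$ (0, i) = (y * ?B * K) $$ (0, i))"
    unfolding d' using rK[OF yB] by simp
  also have "\<dots> \<longleftrightarrow> x = y * ?B * K"
  proof
    assume "\<forall>i<n. x $$ (0, i) = (y * ?B * K) $$ (0, i)"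
    then show "x = y * ?B * K" using x yB K(1) by (intro eq_matI) auto
  qed simp
  also have "\<dots> \<longleftrightarrow> x * A = y"
  proof
    assume "x * A = y"
    then have "y * ?B * K = x * (A * ?B * K)"
      using assoc_mult_mat[OF x A B] assoc_mult_mat[OF x AB K(1)] by simp
    then show "x = y * ?B * K" using x K(2) by simp
  next
    assume eq: "x = y * ?B * K"
    have "x * A * ?B = x * (A * ?B)" by (rule assoc_mult_mat[OF x A B])
    also have "\<dots> = y * ?B * (K * (A * ?B))" unfolding eq by (rule assoc_mult_mat[OF yB K(1) AB])
    also have "\<dots> = y * ?B" unfolding K(3) by (rule right_mult_one_mat[OF yB])
    finally have xAB: "x * A * ?B = y * ?B" .
    have cancel: "v * ?B * (A * L) = v" if v: "v \<in> carrier_mat 1 n" for v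
    proof -
      have "v * ?B * (A * L) = v * (?B * (A * L))"
        by (rule assoc_mult_mat[OF v B mult_carrier_mat[OF A L(1)]])
      also have "?B * (A * L) = 1\<^sub>m n" using assoc_mult_mat[OF B A L(1)] L(2) by simp
      finally show ?thesis using v by simp
    qed
    have "x * A = x * A * ?B * (A * L)" by (rule cancel[symmetric]) (use x A in simp)
    also have "\<dots> = y" unfolding xAB by (rule cancel[OF y])
    finally show "x * A = y" .
  qed
  finally show ?thesis by blast
qed

end
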